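(* Let $r\ge 3$ and let $f\in C^{2r-1}(z)$, i.e. $f$ is of class $C^{2r-1}$ on $(z-\delta,z+\delta)$ for some $\delta>0$. Let $q(x_{1/2})$ be the OWENO reconstruction at $x_{1/2}$, with exponents $s_1,s_2>0$ and parameter $\varepsilon>0$, built from the data of $f$ (point values or cell averages) on the stencil $\{x_{-r+1},\dots,x_{r-1}\}$ of mesh width $h$. Then $$f(x_{1/2})-q(x_{1/2})=\mathcal O(h^{2r-1})+\mathcal O(\varepsilon^{s_2}).$$
   Context: Stencil: $x_\lambda=z+(\alpha+\lambda)h$ with $\alpha\in\mathbb{R}$ fixed and $h>0$, for integer and half-integer $\lambda$. $\Pi_n$ is the space of real polynomials of degree at most $n$. Data: either point values $f_j=f(x_j)$, or cell averages $f_j=\frac1h\int_{x_{j-1/2}}^{x_{j+1/2}}f(x)\,dx$, $-r+1\le j\le r-1$. The reconstruction polynomial of a set of $m$ consecutive nodes is the polynomial in $\Pi_{m-1}$ whose point values (resp. cell averages over $[x_{j-1/2},x_{j+1/2}]$) at these nodes $x_j$ equal the $f_j$. For $0\le i\le r-1$, $p_i\in\Pi_{r-1}$ is the reconstruction polynomial of the substencil $\{x_{-r+1+i},\dots,x_i\}$; $p_h\in\Pi_{2r-2}$ is the reconstruction polynomial of the whole stencil. The ideal linear weights $c_0,\dots,c_{r-1}>0$, $\sum_i c_i=1$, are such that $\sum_{i=0}^{r-1}c_i p_i(x_{1/2})=p_h(x_{1/2})$. Jiang-Shu smoothness indicators: $I_i=\sum_{l=1}^{r-1}\int_{x_{-1/2}}^{x_{1/2}}h^{2l-1}\bigl(p_i^{(l)}(x)\bigr)^2\,dx$.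 Further quantities: $$d_1=\Biggl(\sum_{j=-r+1}^{r-1}(-1)^{j+r-1}\binom{2r-2}{j+r-1}f_j\Biggr)^2,\qquad d_2=B_h^2-4A_hC_h,$$ where $P_h(w)=p_h(z+wh)$ and $P_h^{(2r-4)}(w)=A_hw^2+B_hw+C_h$; $$d=\frac{d_1^{s_1}|d_2|^{s_1}}{d_1^{s_1}+|d_2|^{s_1}+\varepsilon}.$$ OWENO weights and reconstruction: $$\alpha_i=c_i\left(1+\frac{d}{I_i^{s_1}+\varepsilon}\right)^{s_2},\qquad \omega_i=\frac{\alpha_i}{\alpha_0+\dots+\alpha_{r-1}},\qquad q(x_{1/2})=\sum_{i=0}^{r-1}\omega_i\,p_i(x_{1/2}).$$
   Formalization: The exponent s_1 is assumed to be at least 1 instead of merely positive; for s_1<1 the claim fails, e.g. r=3, point values, z=α=0, f=x^3+x^4, where the error is of order h^{3+2s_1} as ε tends to 0. *)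

theory Defs
  imports "HOL-Analysis.Analysis" "HOL-Computational_Algebra.Polynomial"
begin

text \<open>Only meaningful for open \<open>S\<close>, since \<^const>\<open>deriv\<close> is the two-sided derivative.\<close>

definition Ck_on :: "nat \<Rightarrow> (real \<Rightarrow> real) \<Rightarrow> real set \<Rightarrow> bool" where
  "Ck_on k f S \<longleftrightarrow>
     (\<forall>i<k. \<forall>x\<in>S. (deriv ^^ i) f differentiable at x) \<and> continuous_on S ((deriv ^^ k) f)"

definition node :: "real \<Rightarrow> real \<Rightarrow> real \<Rightarrow> real \<Rightarrow> real" where
  "node z \<alpha> h l = z + (\<alpha> + l) * h"

datatype data_kind = Point_Values | Cell_Averages

fun datum :: "data_kind \<Rightarrow> real \<Rightarrow> real \<Rightarrow> real \<Rightarrow> (real \<Rightarrow> real) \<Rightarrow> int \<Rightarrow> real" where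
  "datum Point_Values z \<alpha> h f j = f (node z \<alpha> h (of_int j))"
| "datum Cell_Averages z \<alpha> h f j =
     1 / h * integral {node z \<alpha> h (of_int j - 1/2)..node z \<alpha> h (of_int j + 1/2)} f"

text \<open>
  Reconstruction polynomial of the \<open>m\<close> consecutive nodes with indices \<open>a, ..., a + m - 1\<close>
  (\<open>m \<ge> 1\<close>) for the data \<open>u\<close>. It exists and is unique for \<open>h > 0\<close>.
\<close>

definition reconstruction_poly ::
  "data_kind \<Rightarrow> real \<Rightarrow> real \<Rightarrow> real \<Rightarrow> (int \<Rightarrow> real) \<Rightarrow> int \<Rightarrow> nat \<Rightarrow> real poly" where
  "reconstruction_poly kind z \<alpha> h u a m =
     (THE p. degree p \<le> m - 1 \<and> (\<forall>j\<in>{a..<a + int m}. datum kind z \<alpha> h (poly p) j = u j))"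

definition sub_poly ::
  "data_kind \<Rightarrow> nat \<Rightarrow> real \<Rightarrow> real \<Rightarrow> real \<Rightarrow> (int \<Rightarrow> real) \<Rightarrow> nat \<Rightarrow> real poly" where
  "sub_poly kind r z \<alpha> h u i = reconstruction_poly kind z \<alpha> h u (- int r + 1 + int i) r"

definition full_poly ::
  "data_kind \<Rightarrow> nat \<Rightarrow> real \<Rightarrow> real \<Rightarrow> real \<Rightarrow> (int \<Rightarrow> real) \<Rightarrow> real poly" where
  "full_poly kind r z \<alpha> h u = reconstruction_poly kind z \<alpha> h u (- int r + 1) (2 * r - 1)"

text \<open>The linear weights are constants, valid for all mesh widths and all data.\<close>

definition ideal_linear_weights ::
  "data_kind \<Rightarrow> nat \<Rightarrow> real \<Rightarrow> real \<Rightarrow> (nat \<Rightarrow> real) \<Rightarrow> bool" where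
  "ideal_linear_weights kind r z \<alpha> c \<longleftrightarrow>
     (\<forall>i<r. c i > 0) \<and> (\<Sum>i<r. c i) = 1 \<and>
     (\<forall>h>0. \<forall>u. (\<Sum>i<r. c i * poly (sub_poly kind r z \<alpha> h u i) (node z \<alpha> h (1/2)))
               = poly (full_poly kind r z \<alpha> h u) (node z \<alpha> h (1/2)))"

definition smoothness_indicator ::
  "data_kind \<Rightarrow> nat \<Rightarrow> real \<Rightarrow> real \<Rightarrow> real \<Rightarrow> (int \<Rightarrow> real) \<Rightarrow> nat \<Rightarrow> real" where
  "smoothness_indicator kind r z \<alpha> h u i =
     (\<Sum>l=1..r - 1. integral {node z \<alpha> h (- 1/2)..node z \<alpha> h (1/2)}
        (\<lambda>x. h ^ (2 * l - 1) * (poly ((pderiv ^^ l) (sub_poly kind r z \<alpha> h u i)) x)\<^sup>2))"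

definition d1 :: "nat \<Rightarrow> (int \<Rightarrow> real) \<Rightarrow> real" where
  "d1 r u = (\<Sum>j = - int r + 1..int r - 1.
      (- 1) ^ nat (j + int r - 1) * real ((2 * r - 2) choose nat (j + int r - 1)) * u j)\<^sup>2"

text \<open>
  \<open>Q\<close> is the derivative of order \<open>2r - 4\<close> of \<open>P\<^sub>h(w) = p\<^sub>h(z + w h)\<close>, a polynomial in \<open>w\<close> of
  degree at most 2; \<open>d2\<close> is its discriminant.
\<close>

definition d2 :: "data_kind \<Rightarrow> nat \<Rightarrow> real \<Rightarrow> real \<Rightarrow> real \<Rightarrow> (int \<Rightarrow> real) \<Rightarrow> real" where
  "d2 kind r z \<alpha> h u =
     (let Q = (pderiv ^^ (2 * r - 4)) (pcompose (full_poly kind r z \<alpha> h u) [:z, h:])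
      in (coeff Q 1)\<^sup>2 - 4 * coeff Q 2 * coeff Q 0)"

definition oweno_d ::
  "data_kind \<Rightarrow> nat \<Rightarrow> real \<Rightarrow> real \<Rightarrow> real \<Rightarrow> real \<Rightarrow> real \<Rightarrow> (int \<Rightarrow> real) \<Rightarrow> real" where
  "oweno_d kind r z \<alpha> s1 \<epsilon> h u =
     d1 r u powr s1 * \<bar>d2 kind r z \<alpha> h u\<bar> powr s1 /
       (d1 r u powr s1 + \<bar>d2 kind r z \<alpha> h u\<bar> powr s1 + \<epsilon>)"

definition unnormalized_weight ::
  "data_kind \<Rightarrow> nat \<Rightarrow> real \<Rightarrow> real \<Rightarrow> (nat \<Rightarrow> real) \<Rightarrow> real \<Rightarrow> real \<Rightarrow> real \<Rightarrow> real
     \<Rightarrow> (int \<Rightarrow> real) \<Rightarrow> nat \<Rightarrow> real" where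
  "unnormalized_weight kind r z \<alpha> c s1 s2 \<epsilon> h u i =
     c i * (1 + oweno_d kind r z \<alpha> s1 \<epsilon> h u /
                  (smoothness_indicator kind r z \<alpha> h u i powr s1 + \<epsilon>)) powr s2"

definition oweno_weight ::
  "data_kind \<Rightarrow> nat \<Rightarrow> real \<Rightarrow> real \<Rightarrow> (nat \<Rightarrow> real) \<Rightarrow> real \<Rightarrow> real \<Rightarrow> real \<Rightarrow> real
     \<Rightarrow> (int \<Rightarrow> real) \<Rightarrow> nat \<Rightarrow> real" where
  "oweno_weight kind r z \<alpha> c s1 s2 \<epsilon> h u i =
     unnormalized_weight kind r z \<alpha> c s1 s2 \<epsilon> h u i /
       (\<Sum>k<r. unnormalized_weight kind r z \<alpha> c s1 s2 \<epsilon> h u k)"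

definition oweno_reconstruction ::
  "data_kind \<Rightarrow> nat \<Rightarrow> real \<Rightarrow> real \<Rightarrow> (nat \<Rightarrow> real) \<Rightarrow> real \<Rightarrow> real \<Rightarrow> real \<Rightarrow> real
     \<Rightarrow> (int \<Rightarrow> real) \<Rightarrow> real" where
  "oweno_reconstruction kind r z \<alpha> c s1 s2 \<epsilon> h u =
     (\<Sum>i<r. oweno_weight kind r z \<alpha> c s1 s2 \<epsilon> h u i *
              poly (sub_poly kind r z \<alpha> h u i) (node z \<alpha> h (1/2)))"

end

theory Submission
  imports Defs
begin

text \<open>
  Since both \<open>c\<close> and \<open>\<omega>\<close> sum to 1, the error is
  \<open>f(x) - p\<^sub>h(x) - \<Sum>i. (\<omega>\<^sub>i - c\<^sub>i) (p\<^sub>i(x) - f(z))\<close> at \<open>x = x\<^bsub>1/2\<^esub>\<close>, and the first difference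
  is \<open>O(h\<^bsup>2r-1\<^esup>)\<close>. Let \<open>m \<ge> 1\<close> be minimal with \<open>f\<^bsup>(m)\<^esup>(z) \<noteq> 0\<close>. If \<open>m > 2r - 2\<close>, then each
  \<open>p\<^sub>i(x) - f(z)\<close> is \<open>O(h\<^bsup>2r-1\<^esup>)\<close>. Otherwise \<open>p\<^sub>i(x) - f(z) = O(h\<^bsup>m\<^esup>)\<close>, and \<open>I\<^sub>i\<close> is bounded below
  by a multiple of \<open>h\<^bsup>2m\<^esup>\<close>, because the reconstruction of \<open>w\<^bsup>m\<^esup>\<close> from \<open>r \<ge> 3\<close> nodes is not
  constant. Now \<open>d \<le> d\<^sub>1\<^bsup>s\<^sub>1\<^esup>\<close> with \<open>d\<^sub>1 = O(h\<^bsup>4r-4\<^esup>)\<close>, hence \<open>\<omega>\<^sub>i - c\<^sub>i = O(h\<^bsup>4r-4-2m\<^esup>)\<close>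
  as \<open>s\<^sub>1 \<ge> 1\<close>, which
  suffices for \<open>m \<le> 2r - 3\<close>. For \<open>m = 2r - 2\<close> the factor \<open>h\<close> that is missing comes from
  \<open>d \<le> \<bar>d\<^sub>2\<bar>\<^bsup>s\<^sub>1\<^esup>\<close> and \<open>d\<^sub>2 = O(h\<^bsup>4r-3\<^esup>)\<close>. All bounds are uniform in \<open>\<epsilon>\<close>.
\<close>

section \<open>Data functionals and their reduction to the unit mesh\<close>

lemma integral_affine:
  fixes g :: "real \<Rightarrow> real"
  assumes "h > 0" "a \<le> b" "continuous_on {z + h * a..z + h * b} g"
  shows "integral {z + h * a..z + h * b} g = h * integral {a..b} (\<lambda>w. g (z + h * w))"
proof -
  have img: "z + h * w \<in> {z + h * a..z + h * b}" if "w \<in> {a..b}" for w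
    using that assms(1) by auto
  have "((\<lambda>w. h *\<^sub>R g (z + h * w)) has_integral
          integral {z + h * a..z + h * b} g) {a..b}"
    by (rule has_integral_substitution[where c = "z + h * a" and d = "z + h * b"])
      (use assms img in \<open>auto intro!: derivative_eq_intros simp: mult_left_mono\<close>)
  then have "integral {a..b} (\<lambda>w. h *\<^sub>R g (z + h * w)) = integral {z + h * a..z + h * b} g"
    by (rule integral_unique)
  moreover have "integral {a..b} (\<lambda>w. h *\<^sub>R g (z + h * w)) =
      h * integral {a..b} (\<lambda>w. g (z + h * w))"
    using integral_cmul[of "{a..b}" h "\<lambda>w. g (z + h * w)"] by (simp only: real_scaleR_def)
  ultimately show ?thesis by simp
qed

lemma integral_pderiv:
  assumes "a \<le> b"
  shows "integral {a..b} (poly (pderiv p)) = poly p b - poly p (a::real)"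
proof -
  have "(poly (pderiv p) has_integral poly p b - poly p a) {a..b}"
    using assms poly_DERIV[of p]
    by (intro fundamental_theorem_of_calculus)
      (auto simp: has_real_derivative_iff_has_vector_derivative[symmetric]
         intro: has_field_derivative_at_within)
  then show ?thesis by (rule integral_unique)
qed

text \<open>The control volume of node \<open>j\<close> in the scaled variable
  \<open>w = (x - z) / h\<close>. It also contains the node itself, so a hypothesis on
  \<open>cell \<alpha> j\<close> serves point values as well as averages.\<close>

definition cell :: "real \<Rightarrow> int \<Rightarrow> real set" where
  "cell \<alpha> j = {\<alpha> + of_int j - 1/2..\<alpha> + of_int j + 1/2}"

text \<open>The factor \<open>1 / h\<close> of a cell average cancels the Jacobian of
  \<open>w \<mapsto> z + h * w\<close>. Everything can thus be moved to \<open>z = 0\<close>,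
  \<open>h = 1\<close>, where constants cannot depend on \<open>h\<close>.\<close>

lemma datum_rescale:
  assumes "h > 0" "continuous_on ((\<lambda>w. z + h * w) ` cell \<alpha> j) g"
  shows "datum kind z \<alpha> h g j = datum kind 0 \<alpha> 1 (\<lambda>w. g (z + h * w)) j"
proof (cases kind)
  case Point_Values
  then show ?thesis by (simp add: node_def mult.commute)
next
  case Cell_Averages
  let ?a = "\<alpha> + of_int j - 1/2" and ?b = "\<alpha> + of_int j + 1/2"
  have "(\<lambda>w. z + h * w) ` cell \<alpha> j = {z + h * ?a..z + h * ?b}"
    using image_affinity_atLeastAtMost[of h z ?a ?b] assms(1)
    by (simp add: cell_def add.commute)
  then have "integral {z + h * ?a..z + h * ?b} g = h * integral {?a..?b} (\<lambda>w. g (z + h * w))"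
    using assms by (intro integral_affine) auto
  then show ?thesis
    using assms(1) Cell_Averages by (simp add: node_def mult.commute algebra_simps)
qed

lemma datum_poly_rescale:
  "h > 0 \<Longrightarrow> datum kind z \<alpha> h (poly p) j = datum kind 0 \<alpha> 1 (poly (pcompose p [:z, h:])) j"
  by (subst datum_rescale) (auto intro!: continuous_on_poly
      arg_cong[where f = "\<lambda>g. datum kind 0 \<alpha> 1 g j"] simp: poly_pcompose mult.commute
      simp del: datum.simps)

lemma unit_datum_lincomb:
  assumes "continuous_on (cell \<alpha> j) f" "continuous_on (cell \<alpha> j) g"
  shows "datum kind 0 \<alpha> 1 (\<lambda>w. a * f w + b * g w) j =
    a * datum kind 0 \<alpha> 1 f j + b * datum kind 0 \<alpha> 1 g j"
proof (cases kind)
  case Cell_Averages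
  have "(\<lambda>w. a * f w) integrable_on cell \<alpha> j" "(\<lambda>w. b * g w) integrable_on cell \<alpha> j"
    using assms by (auto simp: cell_def intro!: integrable_continuous_real continuous_intros)
  then have "integral (cell \<alpha> j) (\<lambda>w. a * f w + b * g w) =
      a * integral (cell \<alpha> j) f + b * integral (cell \<alpha> j) g"
    by (subst integral_add) simp_all
  then show ?thesis using Cell_Averages by (simp add: node_def cell_def diff_add_eq add_diff_eq add.assoc)
qed simp

lemma unit_datum_poly_sum:
  assumes "finite A"
  shows "datum kind 0 \<alpha> 1 (poly (\<Sum>i\<in>A. smult (c i) (p i))) j =
    (\<Sum>i\<in>A. c i * datum kind 0 \<alpha> 1 (poly (p i)) j)"
  using assms
proof (induction A)
  case empty
  show ?case by (cases kind) auto
next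
  case (insert x A)
  then show ?case
    using unit_datum_lincomb[of \<alpha> j "poly (p x)" "poly (\<Sum>i\<in>A. smult (c i) (p i))" kind "c x" 1]
    by (simp add: continuous_on_poly poly_sum[symmetric] del: datum.simps
        flip: poly_add poly_smult)
qed

lemma unit_datum_bound:
  assumes "continuous_on (cell \<alpha> j) g" "\<And>w. w \<in> cell \<alpha> j \<Longrightarrow> \<bar>g w\<bar> \<le> E"
  shows "\<bar>datum kind 0 \<alpha> 1 g j\<bar> \<le> E"
proof (cases kind)
  case Point_Values
  then show ?thesis using assms(2)[of "\<alpha> + of_int j"] by (simp add: node_def cell_def)
next
  case Cell_Averages
  then show ?thesis
    using integral_bound[of "\<alpha> + of_int j - 1/2" "\<alpha> + of_int j + 1/2" g E] assms
    by (simp add: node_def cell_def add_diff_eq add.assoc)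
qed

text \<open>For averages this is the mean value theorem applied to a primitive. The zero lies in the
  open cell; open cells of distinct nodes are disjoint, so zeros found in different cells are
  distinct.\<close>

lemma unit_datum_zero:
  assumes "continuous_on (cell \<alpha> j) g" "datum kind 0 \<alpha> 1 g j = 0"
  obtains w where "\<alpha> + of_int j - 1/2 < w" "w < \<alpha> + of_int j + 1/2" "g w = 0"
proof (cases kind)
  case Point_Values
  then show ?thesis using that[of "\<alpha> + of_int j"] assms by (simp add: node_def)
next
  case Cell_Averages
  let ?a = "\<alpha> + of_int j - 1/2" and ?b = "\<alpha> + of_int j + 1/2"
  let ?F = "\<lambda>x. integral {?a..x} g"
  have der: "(?F has_real_derivative g x) (at x within {?a..?b})" if "x \<in> {?a..?b}" for x
    using integral_has_real_derivative[of ?a ?b g x] assms(1) that by (simp add: cell_def)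
  have "\<exists>x. ?a < x \<and> x < ?b \<and> ?F ?b - ?F ?a = g x * (?b - ?a)"
  proof -
    have "\<exists>x\<in>{?a<..<?b}. ?F ?b - ?F ?a = (\<lambda>y. g x * y) (?b - ?a)"
    proof (rule mvt_simple)
      show "(?F has_derivative (\<lambda>y. g x * y)) (at x within {?a..?b})" if "?a \<le> x" "x \<le> ?b" for x
        using der[of x] that by (simp add: has_field_derivative_def)
    qed simp
    then show ?thesis by auto
  qed
  moreover have "?F ?b = 0"
    using assms(2) Cell_Averages by (simp add: node_def add_diff_eq add.assoc)
  ultimately show ?thesis using that by auto
qed

section \<open>Reconstruction on the unit mesh\<close>

text \<open>Newton's scheme: the next condition is met by adding a multiple of the polynomial
  \<open>v\<close>, which vanishes at all earlier nodes.\<close>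

lemma interpolation_exists:
  fixes x :: "nat \<Rightarrow> 'a::field"
  assumes "inj_on x {..m}"
  shows "\<exists>p. degree p \<le> m \<and> (\<forall>k\<le>m. poly p (x k) = y k)"
  using assms
proof (induction m)
  case 0
  show ?case by (rule exI[of _ "[:y 0:]"]) auto
next
  case (Suc m)
  then obtain p where p: "degree p \<le> m" "\<forall>k\<le>m. poly p (x k) = y k"
    by (meson atMost_subset_iff inj_on_subset le_SucI le_refl)
  define v where "v = (\<Prod>k\<le>m. [:- x k, 1:])"
  have v: "degree v \<le> Suc m"
    unfolding v_def by (rule order.trans[OF degree_prod_sum_le]) auto
  have nz: "poly v (x (Suc m)) \<noteq> 0"
  proof -
    have "x (Suc m) \<noteq> x k" if "k \<le> m" for k
      using Suc.prems that by (auto dest: inj_onD)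
    then show ?thesis by (auto simp: v_def poly_prod)
  qed
  have z: "poly v (x k) = 0" if "k \<le> m" for k
    using that by (auto simp: v_def poly_prod)
  let ?q = "p + smult ((y (Suc m) - poly p (x (Suc m))) / poly v (x (Suc m))) v"
  have "degree ?q \<le> Suc m"
    using p v by (intro degree_add_le order.trans[OF degree_smult_le]) auto
  moreover have "poly ?q (x k) = y k" if "k \<le> Suc m" for k
    using that p(2) z nz by (cases "k = Suc m") auto
  ultimately show ?case by blast
qed

text \<open>Each vanishing datum puts a zero of \<open>p\<close> into its own open cell, and
  \<open>m\<close> distinct zeros are too many for a nonzero polynomial of degree at most
  \<open>m - 1\<close>.\<close>

lemma unit_data_zero_imp_zero:
  assumes "degree p \<le> m - 1" "m \<ge> 1" "\<forall>j\<in>{a..<a + int m}. datum kind 0 \<alpha> 1 (poly p) j = 0"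
  shows "p = 0"
proof (rule ccontr)
  assume nz: "p \<noteq> 0"
  have "\<exists>w. \<alpha> + of_int j - 1/2 < w \<and> w < \<alpha> + of_int j + 1/2 \<and> poly p w = 0"
    if "j \<in> {a..<a + int m}" for j
    by (rule unit_datum_zero[of \<alpha> j "poly p" kind])
      (use assms(3) that in \<open>auto intro: continuous_on_poly\<close>)
  then obtain w where w: "\<And>j. j \<in> {a..<a + int m} \<Longrightarrow>
      \<alpha> + of_int j - 1/2 < w j \<and> w j < \<alpha> + of_int j + 1/2 \<and> poly p (w j) = 0"
    by metis
  have "inj_on w {a..<a + int m}"
  proof (rule inj_onI)
    fix i j assume ij: "i \<in> {a..<a + int m}" "j \<in> {a..<a + int m}" "w i = w j"
    then have "\<bar>real_of_int i - real_of_int j\<bar> < 1" using w[of i] w[of j] by linarith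
    then show "i = j" by linarith
  qed
  then have "m = card (w ` {a..<a + int m})" by (simp add: card_image)
  also have "\<dots> \<le> card {x. poly p x = 0}"
    using w by (intro card_mono poly_roots_finite nz) auto
  also have "\<dots> \<le> degree p" by (rule card_poly_roots_bound[OF nz])
  finally show False using assms by linarith
qed

lemma unit_data_unique:
  assumes "degree p \<le> m - 1" "degree q \<le> m - 1" "m \<ge> 1"
    "\<And>j. j \<in> {a..<a + int m} \<Longrightarrow> datum kind 0 \<alpha> 1 (poly p) j = datum kind 0 \<alpha> 1 (poly q) j"
  shows "p = q"
proof -
  have "datum kind 0 \<alpha> 1 (poly (p - q)) j = 0" if "j \<in> {a..<a + int m}" for j
    using assms(4)[OF that] unit_datum_lincomb[of \<alpha> j "poly p" "poly q" kind 1 "-1"]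
    by (simp add: continuous_on_poly del: datum.simps flip: poly_diff)
  then have "p - q = 0"
    using assms by (intro unit_data_zero_imp_zero[of _ m a kind \<alpha>]) (auto intro: degree_diff_le)
  then show ?thesis by simp
qed

lemma unit_data_exists:
  assumes "m \<ge> 1"
  shows "\<exists>p. degree p \<le> m - 1 \<and> (\<forall>j\<in>{a..<a + int m}. datum kind 0 \<alpha> 1 (poly p) j = u j)"
proof (cases kind)
  case Point_Values
  obtain p where p: "degree p \<le> m - 1"
    "\<forall>k\<le>m - 1. poly p (\<alpha> + of_int (a + int k)) = u (a + int k)"
    using interpolation_exists[of "\<lambda>k. \<alpha> + of_int (a + int k)" "m - 1" "\<lambda>k. u (a + int k)"]
    by (auto simp: inj_on_def)
  have "poly p (\<alpha> + of_int j) = u j" if "j \<in> {a..<a + int m}" for j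
    using p(2)[rule_format, of "nat (j - a)"] that by auto
  then show ?thesis using p Point_Values by (auto simp: node_def)
next
  case Cell_Averages
  \<comment> \<open>interpolate a primitive at the cell edges\<close>
  obtain p where p: "degree p \<le> m"
    "\<forall>k\<le>m. poly p (\<alpha> + of_int (a + int k) - 1/2) = (\<Sum>i<k. u (a + int i))"
    using interpolation_exists[of "\<lambda>k. \<alpha> + of_int (a + int k) - 1/2" m "\<lambda>k. \<Sum>i<k. u (a + int i)"]
    by (auto simp: inj_on_def)
  \<comment> \<open>The cell of \<open>j\<close> runs from edge \<open>k\<close> to edge
    \<open>Suc k\<close>, so the average of \<open>pderiv p\<close> is a difference of two
    consecutive partial sums, that is, the single term \<open>u j\<close>.\<close>
  have "datum kind 0 \<alpha> 1 (poly (pderiv p)) j = u j" if j: "j \<in> {a..<a + int m}" for j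
  proof -
    define k where "k = nat (j - a)"
    have k: "j = a + int k" "Suc k \<le> m" using j by (auto simp: k_def)
    have "integral {\<alpha> + of_int j - 1/2..\<alpha> + of_int j + 1/2} (poly (pderiv p)) =
      poly p (\<alpha> + of_int (a + int (Suc k)) - 1/2) - poly p (\<alpha> + of_int (a + int k) - 1/2)"
      by (subst integral_pderiv) (simp_all add: k(1) field_simps)
    also have "\<dots> = u j" using p(2) k(2) by (simp add: k(1) del: of_int_add of_nat_Suc)
    finally show ?thesis using Cell_Averages by (simp add: node_def add_diff_eq add.assoc)
  qed
  then show ?thesis using p(1) by (auto intro!: exI[of _ "pderiv p"] simp: degree_pderiv)
qed

text \<open>Existence and uniqueness make the definite description denote, so its defining
  properties become available.\<close>

lemma unit_reconstruction:
  assumes "m \<ge> 1"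
  shows "degree (reconstruction_poly kind 0 \<alpha> 1 u a m) \<le> m - 1"
    and "\<And>j. j \<in> {a..<a + int m} \<Longrightarrow>
           datum kind 0 \<alpha> 1 (poly (reconstruction_poly kind 0 \<alpha> 1 u a m)) j = u j"
proof -
  have "\<exists>!p. degree p \<le> m - 1 \<and> (\<forall>j\<in>{a..<a + int m}. datum kind 0 \<alpha> 1 (poly p) j = u j)"
    using unit_data_exists[OF assms, of a kind \<alpha> u] assms
    by (auto intro!: unit_data_unique[of _ m _ a kind \<alpha>] simp del: datum.simps)
  from theI'[OF this]
  show "degree (reconstruction_poly kind 0 \<alpha> 1 u a m) \<le> m - 1"
    and "\<And>j. j \<in> {a..<a + int m} \<Longrightarrow>
           datum kind 0 \<alpha> 1 (poly (reconstruction_poly kind 0 \<alpha> 1 u a m)) j = u j"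
    unfolding reconstruction_poly_def by auto
qed

lemma unit_reconstruction_eqI:
  assumes "m \<ge> 1" "degree p \<le> m - 1"
    "\<And>j. j \<in> {a..<a + int m} \<Longrightarrow> datum kind 0 \<alpha> 1 (poly p) j = u j"
  shows "reconstruction_poly kind 0 \<alpha> 1 u a m = p"
  using assms unit_reconstruction[OF assms(1)]
  by (intro unit_data_unique[of _ m _ a kind \<alpha>]) (auto simp del: datum.simps)

text \<open>Composition with an invertible affine map keeps the degree and, by the scale invariance
  of the data, matches the two reconstruction problems. In the variable \<open>w\<close> the
  reconstruction therefore depends on \<open>h\<close> only through the data
  \<open>u\<close>.\<close>

lemma reconstruction_rescale:
  assumes "h > 0" "m \<ge> 1"
  shows "pcompose (reconstruction_poly kind z \<alpha> h u a m) [:z, h:] =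
    reconstruction_poly kind 0 \<alpha> 1 u a m"
proof -
  define R where "R = reconstruction_poly kind 0 \<alpha> 1 u a m"
  define S where "S = pcompose R [:- z / h, 1 / h:]"
  have inv: "pcompose (pcompose q [:- z / h, 1 / h:]) [:z, h:] = q"
    "pcompose (pcompose q [:z, h:]) [:- z / h, 1 / h:] = q" for q
    using assms(1) by (simp_all flip: pcompose_assoc add: pcompose_pCons)
  have SR: "pcompose S [:z, h:] = R" unfolding S_def by (rule inv)
  have deg: "degree (pcompose q [:z, h:]) = degree q" for q
    using assms(1) by (simp add: degree_pcompose)
  have "reconstruction_poly kind z \<alpha> h u a m = S"
    unfolding reconstruction_poly_def
  proof (rule the_equality)
    have "degree S \<le> m - 1"
      using unit_reconstruction(1)[OF assms(2), of kind \<alpha> u a] assms(1)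
      by (simp add: S_def R_def degree_pcompose)
    then show "degree S \<le> m - 1 \<and> (\<forall>j\<in>{a..<a + int m}. datum kind z \<alpha> h (poly S) j = u j)"
      using unit_reconstruction(2)[OF assms(2), of _ a kind \<alpha> u] assms(1)
      by (simp add: datum_poly_rescale[of h _ z] SR R_def del: datum.simps)
  next
    fix q assume q: "degree q \<le> m - 1 \<and> (\<forall>j\<in>{a..<a + int m}. datum kind z \<alpha> h (poly q) j = u j)"
    have "R = pcompose q [:z, h:]"
      unfolding R_def
      by (rule unit_reconstruction_eqI)
        (use q assms in \<open>auto simp: datum_poly_rescale[of h _ z] deg simp del: datum.simps\<close>)
    then show "q = S" using inv(2)[of q] by (simp add: S_def)
  qed
  then show ?thesis by (simp add: SR R_def)
qed

text \<open>The Lagrange basis, for either kind of data. It lives on the unit mesh, so norms taken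
  from it are constants with respect to \<open>h\<close>.\<close>

definition cardinal_poly :: "data_kind \<Rightarrow> real \<Rightarrow> int \<Rightarrow> nat \<Rightarrow> int \<Rightarrow> real poly" where
  "cardinal_poly kind \<alpha> a m j = reconstruction_poly kind 0 \<alpha> 1 (\<lambda>k. if k = j then 1 else 0) a m"

lemma unit_reconstruction_eq_sum:
  assumes "m \<ge> 1"
  shows "reconstruction_poly kind 0 \<alpha> 1 u a m =
    (\<Sum>j\<in>{a..<a + int m}. smult (u j) (cardinal_poly kind \<alpha> a m j))"
proof (rule unit_reconstruction_eqI)
  show "degree (\<Sum>j\<in>{a..<a + int m}. smult (u j) (cardinal_poly kind \<alpha> a m j)) \<le> m - 1"
    using unit_reconstruction(1)[OF assms]
    by (intro degree_sum_le) (auto simp: cardinal_poly_def intro: order.trans[OF degree_smult_le])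
  fix k assume k: "k \<in> {a..<a + int m}"
  show "datum kind 0 \<alpha> 1 (poly (\<Sum>j\<in>{a..<a + int m}. smult (u j) (cardinal_poly kind \<alpha> a m j))) k = u k"
    using k unit_reconstruction(2)[OF assms k]
    by (subst unit_datum_poly_sum) (auto simp: cardinal_poly_def if_distrib cong: if_cong simp del: datum.simps)
qed (rule assms)

section \<open>Finite differences and smoothness indicators\<close>

text \<open>Node \<open>j + 1\<close> seen from origin 0 is node \<open>j\<close> seen from origin
  1; the rescaling with \<open>h = 1\<close> then moves the origin back.\<close>

lemma datum_shift:
  "datum kind 0 \<alpha> 1 (poly p) (j + 1) = datum kind 0 \<alpha> 1 (poly (pcompose p [:1, 1:])) j"
proof -
  have "datum kind 1 \<alpha> 1 (poly p) j = datum kind 0 \<alpha> 1 (poly p) (j + 1)"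
    by (cases kind) (simp_all add: node_def algebra_simps)
  then show ?thesis using datum_poly_rescale[of 1 kind 1 \<alpha> p j] by simp
qed

text \<open>Pascal's rule: a difference of order \<open>Suc n\<close> is the difference of order
  \<open>n\<close> of the first differences.\<close>

lemma alternating_binomial_sum_Suc:
  fixes g :: "nat \<Rightarrow> 'a::comm_ring_1"
  shows "(\<Sum>k\<le>Suc n. (- 1) ^ k * of_nat (Suc n choose k) * g k) =
    (\<Sum>k\<le>n. (- 1) ^ k * of_nat (n choose k) * (g k - g (Suc k)))"
proof -
  have "(\<Sum>k\<le>n. (- 1) ^ k * of_nat (n choose k) * g k) =
      (\<Sum>k\<le>Suc n. (- 1) ^ k * of_nat (n choose k) * g k)"
    by (simp add: binomial_eq_0)
  also have "\<dots> = g 0 - (\<Sum>k\<le>n. (- 1) ^ k * of_nat (n choose Suc k) * g (Suc k))"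
    by (subst sum.atMost_Suc_shift) (simp add: sum_negf binomial_eq_0)
  finally show ?thesis
    by (subst sum.atMost_Suc_shift)
      (simp add: algebra_simps sum.distrib sum_subtractf sum_negf)
qed

text \<open>Translation keeps the leading coefficient, which therefore cancels. The first disjunct
  covers constants, whose degree cannot drop.\<close>

lemma degree_diff_shift:
  fixes p :: "real poly"
  shows "p - pcompose p [:1, 1:] = 0 \<or> degree (p - pcompose p [:1, 1:]) < degree p"
proof (rule eq_zero_or_degree_less)
  have "lead_coeff (pcompose p [:1, 1:]) = lead_coeff p" by (subst lead_coeff_comp) auto
  then show "coeff (p - pcompose p [:1, 1:]) (degree p) = 0" by (simp add: degree_pcompose)
qed (auto intro: degree_diff_le simp: degree_pcompose)

text \<open>Each difference of data is the datum of a polynomial of lower degree, so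
  \<open>n\<close> differences annihilate degree less than \<open>n\<close>. The alternative
  \<open>p = 0\<close> carries the induction down to \<open>n = 0\<close>.\<close>

lemma finite_difference_poly_data:
  assumes "degree p < n \<or> p = 0"
  shows "(\<Sum>k\<le>n. (- 1) ^ k * real (n choose k) * datum kind 0 \<alpha> 1 (poly p) (a + int k)) = 0"
  using assms
proof (induction n arbitrary: p)
  case 0
  then have "p = 0" by simp
  then show ?case by (cases kind) simp_all
next
  case (Suc n)
  let ?q = "p - pcompose p [:1, 1:]"
  have "datum kind 0 \<alpha> 1 (poly p) (a + int k) - datum kind 0 \<alpha> 1 (poly p) (a + int (Suc k)) =
      datum kind 0 \<alpha> 1 (poly ?q) (a + int k)" for k
    using unit_datum_lincomb[of \<alpha> "a + int k" "poly p" "poly (pcompose p [:1, 1:])" kind 1 "-1"]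
      datum_shift[of kind \<alpha> p "a + int k"]
    by (simp add: continuous_on_poly add.commute add.left_commute del: datum.simps flip: poly_diff)
  moreover have "(\<Sum>k\<le>n. (- 1) ^ k * real (n choose k) *
      datum kind 0 \<alpha> 1 (poly ?q) (a + int k)) = 0"
    using Suc.prems degree_diff_shift[of p] by (intro Suc.IH) auto
  ultimately show ?case by (subst alternating_binomial_sum_Suc) (simp only:)
qed

lemma d1_eq:
  assumes "r \<ge> 1"
  shows "d1 r u =
    (\<Sum>k\<le>2 * r - 2. (- 1) ^ k * real ((2 * r - 2) choose k) * u (- int r + 1 + int k))\<^sup>2"
proof -
  have "(\<Sum>j = - int r + 1..int r - 1.
      (- 1) ^ nat (j + int r - 1) * real ((2 * r - 2) choose nat (j + int r - 1)) * u j) =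
    (\<Sum>k\<le>2 * r - 2. (- 1) ^ k * real ((2 * r - 2) choose k) * u (- int r + 1 + int k))"
    by (rule sum.reindex_bij_witness[of _ "\<lambda>k. - int r + 1 + int k" "\<lambda>j. nat (j + int r - 1)"])
      (use assms in auto)
  then show ?thesis by (simp add: d1_def)
qed

lemma pderiv_pcompose_linear:
  "pderiv (pcompose p [:z, h:]) = smult h (pcompose (pderiv p) [:z, h:])"
  by (simp add: pderiv_pcompose pderiv_pCons mult.commute)

text \<open>All summands are nonnegative, so the one with \<open>l = 1\<close> is a lower bound. Its
  factor \<open>h\<close> and the Jacobian \<open>h\<close> are exactly the square of the chain rule
  factor, hence no \<open>h\<close> is left on the unit mesh.\<close>

lemma smoothness_indicator_ge:
  assumes "h > 0" "r \<ge> 2"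
  shows "integral (cell \<alpha> 0) (\<lambda>w. (poly (pderiv
      (reconstruction_poly kind 0 \<alpha> 1 u (- int r + 1 + int i) r)) w)\<^sup>2)
    \<le> smoothness_indicator kind r z \<alpha> h u i"
proof -
  define p where "p = sub_poly kind r z \<alpha> h u i"
  let ?T = "\<lambda>l. integral {z + h * (\<alpha> - 1/2)..z + h * (\<alpha> + 1/2)}
    (\<lambda>x. h ^ (2 * l - 1) * (poly ((pderiv ^^ l) p) x)\<^sup>2)"
  have P: "pcompose p [:z, h:] = reconstruction_poly kind 0 \<alpha> 1 u (- int r + 1 + int i) r"
    unfolding p_def sub_poly_def using assms by (intro reconstruction_rescale) auto
  have "?T 1 = h * integral {\<alpha> - 1/2..\<alpha> + 1/2} (\<lambda>w. h * (poly (pderiv p) (z + h * w))\<^sup>2)"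
    using assms(1) by (subst integral_affine) (auto intro!: continuous_intros)
  also have "\<dots> = integral {\<alpha> - 1/2..\<alpha> + 1/2} (\<lambda>w. h * (h * (poly (pderiv p) (z + h * w))\<^sup>2))"
    by (simp only: Henstock_Kurzweil_Integration.integral_mult_right)
  also have "\<dots> = integral (cell \<alpha> 0) (\<lambda>w. (poly (pderiv (pcompose p [:z, h:])) w)\<^sup>2)"
    by (simp add: cell_def pderiv_pcompose_linear poly_pcompose power2_eq_square algebra_simps)
  finally have 1: "?T 1 = \<dots>" .
  have "?T 1 = sum ?T {1}" by simp
  also have "\<dots> \<le> sum ?T {1..r - 1}"
    using assms
    by (intro sum_mono2) (auto intro!: mult_nonneg_nonneg integral_nonneg integrable_continuous_real
        continuous_intros)
  also have "\<dots> = smoothness_indicator kind r z \<alpha> h u i"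
    by (simp add: smoothness_indicator_def p_def node_def algebra_simps)
  finally show ?thesis using 1 by (simp add: P)
qed

text \<open>Pointwise \<open>f^2 - (c g)^2 / 2 + (f - c g)^2 = (2 f - c g)^2 / 2\<close>, which is
  nonnegative. The cell has length 1, so the constant \<open>E^2\<close> integrates to
  itself.\<close>

lemma integral_square_perturbation:
  fixes f g :: "real \<Rightarrow> real"
  assumes "continuous_on (cell \<alpha> 0) f" "continuous_on (cell \<alpha> 0) g"
    "\<And>w. w \<in> cell \<alpha> 0 \<Longrightarrow> \<bar>f w - c * g w\<bar> \<le> E"
  shows "c\<^sup>2 / 2 * integral (cell \<alpha> 0) (\<lambda>w. (g w)\<^sup>2) - E\<^sup>2 \<le> integral (cell \<alpha> 0) (\<lambda>w. (f w)\<^sup>2)"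
proof -
  have int: "(\<lambda>w. (g w)\<^sup>2) integrable_on cell \<alpha> 0" "(\<lambda>w. (f w)\<^sup>2) integrable_on cell \<alpha> 0"
    "(\<lambda>w. c\<^sup>2 / 2 * (g w)\<^sup>2) integrable_on cell \<alpha> 0" "(\<lambda>w. E\<^sup>2) integrable_on cell \<alpha> 0"
    using assms(1,2) unfolding cell_def
    by (auto intro!: integrable_continuous_real continuous_intros)
  have "c\<^sup>2 / 2 * integral (cell \<alpha> 0) (\<lambda>w. (g w)\<^sup>2) - E\<^sup>2 =
      integral (cell \<alpha> 0) (\<lambda>w. c\<^sup>2 / 2 * (g w)\<^sup>2) - integral (cell \<alpha> 0) (\<lambda>w. E\<^sup>2)"
    by (simp add: cell_def)
  also have "\<dots> = integral (cell \<alpha> 0) (\<lambda>w. c\<^sup>2 / 2 * (g w)\<^sup>2 - E\<^sup>2)"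
    using int by (simp add: Henstock_Kurzweil_Integration.integral_diff)
  also have "\<dots> \<le> integral (cell \<alpha> 0) (\<lambda>w. (f w)\<^sup>2)"
  proof (rule integral_le)
    show "(\<lambda>w. c\<^sup>2 / 2 * (g w)\<^sup>2 - E\<^sup>2) integrable_on cell \<alpha> 0"
      using int by (intro integrable_diff)
    fix w assume "w \<in> cell \<alpha> 0"
    then have "\<bar>f w - c * g w\<bar>\<^sup>2 \<le> E\<^sup>2" by (intro power_mono assms(3)) auto
    moreover have "0 \<le> (2 * f w - c * g w)\<^sup>2" by simp
    ultimately show "c\<^sup>2 / 2 * (g w)\<^sup>2 - E\<^sup>2 \<le> (f w)\<^sup>2"
      by (simp add: power2_eq_square algebra_simps)
  qed (rule int)
  finally show ?thesis .
qed

text \<open>A continuous nonnegative integrand with integral 0 vanishes on the whole cell, which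
  would give \<open>p\<close> infinitely many roots.\<close>

lemma integral_cell_poly_square_pos:
  assumes "p \<noteq> 0"
  shows "integral (cell \<alpha> 0) (\<lambda>w. (poly p w)\<^sup>2) > 0"
proof -
  have "integral (cell \<alpha> 0) (\<lambda>w. (poly p w)\<^sup>2) \<noteq> 0"
  proof
    assume "integral (cell \<alpha> 0) (\<lambda>w. (poly p w)\<^sup>2) = 0"
    then have "\<forall>w\<in>cell \<alpha> 0. (poly p w)\<^sup>2 = 0"
      unfolding cell_def by (subst (asm) integral_eq_0_iff) (auto intro!: continuous_intros)
    then have "cell \<alpha> 0 \<subseteq> {w. poly p w = 0}" by auto
    then have "finite (cell \<alpha> 0)" using poly_roots_finite[OF assms] finite_subset by blast
    then show False using infinite_Icc[of "\<alpha> - 1/2" "\<alpha> + 1/2"] by (simp add: cell_def)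
  qed
  moreover have "integral (cell \<alpha> 0) (\<lambda>w. (poly p w)\<^sup>2) \<ge> 0"
    unfolding cell_def
    by (auto intro!: integral_nonneg integrable_continuous_real continuous_intros)
  ultimately show ?thesis by linarith
qed

text \<open>
  Otherwise \<open>w\<^bsup>m\<^esup> - C\<close> would have a zero in each of three disjoint open cells, and its
  derivative two zeros.
\<close>

lemma unit_reconstruction_monom_nonconst:
  assumes "r \<ge> 3" "m \<ge> 1"
  shows "pderiv (reconstruction_poly kind 0 \<alpha> 1
           (datum kind 0 \<alpha> 1 (poly (monom 1 m))) a r) \<noteq> 0"
    (is "pderiv ?G \<noteq> 0")
proof
  assume "pderiv ?G = 0"
  then obtain C where C: "?G = [:C:]"
    by (metis degree_eq_zeroE pderiv_eq_0_iff)
  define q where "q = monom 1 m - [:C:]"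
  have "\<exists>w. \<alpha> + of_int j - 1/2 < w \<and> w < \<alpha> + of_int j + 1/2 \<and> poly q w = 0"
    if "j \<in> {a..<a + int r}" for j
  proof -
    have "datum kind 0 \<alpha> 1 (poly [:C:]) j = datum kind 0 \<alpha> 1 (poly (monom 1 m)) j"
      using unit_reconstruction(2)[of r j a kind \<alpha> "datum kind 0 \<alpha> 1 (poly (monom 1 m))"] that assms
      by (simp add: C del: datum.simps)
    then have "datum kind 0 \<alpha> 1 (poly q) j = 0"
      using unit_datum_lincomb[of \<alpha> j "poly (monom 1 m)" "poly [:C:]" kind 1 "-1"]
      by (simp add: continuous_on_poly q_def del: datum.simps poly_pCons flip: poly_diff)
    then show ?thesis
      by (rule unit_datum_zero[rotated]) (auto intro: continuous_on_poly)
  qed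
  then obtain w where w: "\<And>j. j \<in> {a..<a + int r} \<Longrightarrow>
      \<alpha> + of_int j - 1/2 < w j \<and> w j < \<alpha> + of_int j + 1/2 \<and> poly q (w j) = 0"
    by metis
  have w3: "w a < w (a + 1)" "w (a + 1) < w (a + 2)" "poly q (w a) = 0"
    "poly q (w (a + 1)) = 0" "poly q (w (a + 2)) = 0"
    using w[of a] w[of "a + 1"] w[of "a + 2"] assms(1) by auto
  \<comment> \<open>The derivative is \<open>m w^(m - 1)\<close>, whose only possible zero is 0,
    whereas Rolle's theorem gives one zero on each side of \<open>w (a + 1)\<close>.\<close>
  have crit: "x = 0" if "poly (pderiv q) x = 0" for x
    using that assms(2) by (auto simp: q_def pderiv_diff pderiv_monom poly_monom)
  obtain x where x: "w a < x" "x < w (a + 1)" "poly (pderiv q) x = 0"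
    using poly_MVT[OF w3(1), of q] w3 by auto
  obtain y where y: "w (a + 1) < y" "y < w (a + 2)" "poly (pderiv q) y = 0"
    using poly_MVT[OF w3(2), of q] w3 by auto
  show False using crit[OF x(3)] crit[OF y(3)] x y by linarith
qed

section \<open>Taylor expansion of the data\<close>

text \<open>Halving the radius gives a compact interval, on which the continuous \<open>N\<close>-th
  derivative in the Lagrange remainder is bounded.\<close>

lemma Ck_on_Taylor:
  assumes "Ck_on N f {z - \<delta><..<z + \<delta>}" "\<delta> > 0" "N > 0"
  obtains M where "M \<ge> 0" "\<And>y. \<bar>y\<bar> \<le> \<delta> / 2 \<Longrightarrow>
    \<bar>f (z + y) - (\<Sum>n<N. (deriv ^^ n) f z / fact n * y ^ n)\<bar> \<le> M * \<bar>y\<bar> ^ N"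
proof -
  let ?I = "{z - \<delta> / 2..z + \<delta> / 2}"
  have sub: "?I \<subseteq> {z - \<delta><..<z + \<delta>}" using assms(2) by auto
  have "continuous_on ?I ((deriv ^^ N) f)"
    using assms(1) sub continuous_on_subset unfolding Ck_on_def by blast
  then have "bounded ((deriv ^^ N) f ` ?I)"
    by (intro compact_imp_bounded compact_continuous_image) auto
  then obtain B where B: "\<And>t. t \<in> ?I \<Longrightarrow> \<bar>(deriv ^^ N) f t\<bar> \<le> B"
    unfolding bounded_iff by (metis imageI real_norm_def)
  have "B \<ge> 0" using B[of z] assms(2) by force
  have der: "\<forall>m t. m < N \<and> z - \<delta> / 2 \<le> t \<and> t \<le> z + \<delta> / 2 \<longrightarrow>
      DERIV ((deriv ^^ m) f) t :> (deriv ^^ Suc m) f t"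
  proof (intro allI impI)
    fix m t assume "m < N \<and> z - \<delta> / 2 \<le> t \<and> t \<le> z + \<delta> / 2"
    then have "(deriv ^^ m) f differentiable at t"
      using assms(1) sub unfolding Ck_on_def by auto
    then show "DERIV ((deriv ^^ m) f) t :> (deriv ^^ Suc m) f t"
      by (simp add: DERIV_deriv_iff_real_differentiable)
  qed
  have "\<bar>f (z + y) - (\<Sum>n<N. (deriv ^^ n) f z / fact n * y ^ n)\<bar> \<le> B / fact N * \<bar>y\<bar> ^ N"
    if y: "\<bar>y\<bar> \<le> \<delta> / 2" for y
  proof -
    have "\<exists>t\<in>?I. f (z + y) - (\<Sum>n<N. (deriv ^^ n) f z / fact n * y ^ n) =
        (deriv ^^ N) f t / fact N * y ^ N"
    \<comment> \<open>Taylor's theorem is applied at a point different from the centre. For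
      \<open>y = 0\<close> only the term \<open>n = 0\<close> survives, as
      \<open>0 ^ 0 = 1\<close>.\<close>
    proof (cases "y = 0")
      case True
      have "(\<Sum>n<N. (deriv ^^ n) f z / fact n * y ^ n) =
          (\<Sum>n<N. if n = 0 then f z else 0)"
        using True by (intro sum.cong) auto
      then show ?thesis using True assms(2,3) by (auto intro!: bexI[of _ z])
    next
      case False
      have "z - \<delta> / 2 \<le> z + y" "z + y \<le> z + \<delta> / 2" using y by linarith+
      with False obtain t where "if z + y < z then z + y < t \<and> t < z else z < t \<and> t < z + y"
        "f (z + y) = (\<Sum>m<N. (deriv ^^ m) f z / fact m * (z + y - z) ^ m) +
          (deriv ^^ N) f t / fact N * (z + y - z) ^ N"
        using Taylor[of N "\<lambda>m. (deriv ^^ m) f" f "z - \<delta> / 2" "z + \<delta> / 2" z "z + y"]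
          der assms(2,3) by auto
      then show ?thesis using y by (intro bexI[of _ t]) (auto split: if_splits)
    qed
    then obtain t where t: "t \<in> ?I" "f (z + y) - (\<Sum>n<N. (deriv ^^ n) f z / fact n * y ^ n) =
        (deriv ^^ N) f t / fact N * y ^ N" by blast
    then show ?thesis using B[OF t(1)]
      by (auto simp: abs_mult power_abs intro!: mult_right_mono divide_right_mono)
  qed
  then show ?thesis using that[of "B / fact N"] \<open>B \<ge> 0\<close> by simp
qed

declare datum.simps [simp del]

lemma Ck_on_mono:
  assumes "Ck_on N f S" "m \<le> N" "open S"
  shows "Ck_on m f S"
proof (cases "m = N")
  case False
  then have "\<forall>x\<in>S. (deriv ^^ m) f differentiable at x"
    using assms by (auto simp: Ck_on_def)
  then have "continuous_on S ((deriv ^^ m) f)"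
    by (meson continuous_at_imp_continuous_on differentiable_imp_continuous_within)
  then show ?thesis using assms by (auto simp: Ck_on_def)
qed (use assms in simp)

text \<open>The Taylor polynomial in the scaled variable \<open>w = (x - z) / h\<close>.\<close>

definition taylor_poly :: "nat \<Rightarrow> (real \<Rightarrow> real) \<Rightarrow> real \<Rightarrow> real \<Rightarrow> real poly" where
  "taylor_poly N f z h = (\<Sum>n<N. monom ((deriv ^^ n) f z / fact n * h ^ n) n)"

lemma taylor_poly_eq_const:
  assumes "\<And>n. 1 \<le> n \<Longrightarrow> n < m \<Longrightarrow> (deriv ^^ n) f z = 0" "m \<ge> 1"
  shows "taylor_poly m f z h = [:f z:]"
proof -
  have "taylor_poly m f z h = (\<Sum>n<m. if n = 0 then [:f z:] else 0)"
    unfolding taylor_poly_def using assms(1)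
    by (intro sum.cong) (auto simp: monom_0)
  then show ?thesis using assms(2) by simp
qed

lemma taylor_poly_Suc:
  "taylor_poly (Suc m) f z h = taylor_poly m f z h + monom ((deriv ^^ m) f z / fact m * h ^ m) m"
  by (simp add: taylor_poly_def)

lemma degree_taylor_poly:
  assumes "N \<ge> 1"
  shows "degree (taylor_poly N f z h) \<le> N - 1"
  unfolding taylor_poly_def
  by (intro degree_sum_le) (auto intro: order.trans[OF degree_monom_le])

lemma node_rescale: "node z \<alpha> h l = z + h * (\<alpha> + l)"
  by (simp add: node_def mult.commute)

text \<open>On the unit mesh all arguments have the form \<open>z + h * w\<close> with bounded
  \<open>w\<close>, so the Taylor remainder is uniformly \<open>O(h^N)\<close> and averaging does
  not enlarge it. The range of \<open>j\<close> covers the whole stencil.\<close>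

lemma datum_Taylor:
  assumes "Ck_on N f {z - \<delta><..<z + \<delta>}" "\<delta> > 0" "N > 0"
  obtains M where "M \<ge> 0" "\<forall>\<^sub>F h in at_right 0.
    (\<forall>j. \<bar>j\<bar> \<le> int r \<longrightarrow> \<bar>datum kind z \<alpha> h f j
      - datum kind 0 \<alpha> 1 (poly (taylor_poly N f z h)) j\<bar> \<le> M * h ^ N) \<and>
    \<bar>f (node z \<alpha> h (1/2)) - poly (taylor_poly N f z h) (\<alpha> + 1/2)\<bar> \<le> M * h ^ N"
proof -
  obtain M where M: "M \<ge> 0" "\<And>y. \<bar>y\<bar> \<le> \<delta> / 2 \<Longrightarrow>
    \<bar>f (z + y) - (\<Sum>n<N. (deriv ^^ n) f z / fact n * y ^ n)\<bar> \<le> M * \<bar>y\<bar> ^ N"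
    using Ck_on_Taylor[OF assms] by blast
  \<comment> \<open>\<open>W\<close> bounds the scaled variable on every cell with index at most
    \<open>r\<close> in modulus, and at \<open>\<alpha> + 1/2\<close>.\<close>
  define W where "W = \<bar>\<alpha>\<bar> + real r + 1"
  have "W > 0" by (simp add: W_def)
  have approx: "\<bar>f (z + h * w) - poly (taylor_poly N f z h) w\<bar> \<le> (M * W ^ N) * h ^ N"
    if h: "0 < h" "h * W \<le> \<delta> / 2" and w: "\<bar>w\<bar> \<le> W" for h w
  proof -
    have hw: "\<bar>h * w\<bar> \<le> h * W" using h w by (simp add: abs_mult)
    then have "\<bar>f (z + h * w) - (\<Sum>n<N. (deriv ^^ n) f z / fact n * (h * w) ^ n)\<bar>
        \<le> M * \<bar>h * w\<bar> ^ N"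
      using h by (intro M(2)) linarith
    also have "\<dots> \<le> M * (h * W) ^ N"
      using hw M(1) by (intro mult_left_mono power_mono) auto
    finally show ?thesis
      by (simp add: taylor_poly_def poly_sum poly_monom power_mult_distrib mult_ac)
  qed
  have cont: "continuous_on {z - \<delta><..<z + \<delta>} f"
  proof -
    have "\<forall>x\<in>{z - \<delta><..<z + \<delta>}. f differentiable at x"
      using assms(1,3) unfolding Ck_on_def by (metis funpow_0)
    then show ?thesis
      by (meson continuous_at_imp_continuous_on differentiable_imp_continuous_within)
  qed
  have "\<forall>\<^sub>F h in at_right 0. 0 < h \<and> h < \<delta> / 2 / W"
    using \<open>W > 0\<close> assms(2) by (auto simp: eventually_at_right_field intro!: exI[of _ "\<delta> / 2 / W"])
  then have ev: "\<forall>\<^sub>F h in at_right 0.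
    (\<forall>j. \<bar>j\<bar> \<le> int r \<longrightarrow> \<bar>datum kind z \<alpha> h f j
      - datum kind 0 \<alpha> 1 (poly (taylor_poly N f z h)) j\<bar> \<le> (M * W ^ N) * h ^ N) \<and>
    \<bar>f (node z \<alpha> h (1/2)) - poly (taylor_poly N f z h) (\<alpha> + 1/2)\<bar> \<le> (M * W ^ N) * h ^ N"
  proof (rule eventually_mono, intro conjI allI impI)
    fix h assume "0 < h \<and> h < \<delta> / 2 / W"
    then have h: "0 < h" "h * W < \<delta> / 2" using \<open>W > 0\<close> by (auto simp: pos_less_divide_eq)
    show "\<bar>f (node z \<alpha> h (1/2)) - poly (taylor_poly N f z h) (\<alpha> + 1/2)\<bar> \<le> (M * W ^ N) * h ^ N"
      unfolding node_rescale by (rule approx) (use h in \<open>auto simp: W_def\<close>)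
    fix j :: int assume "\<bar>j\<bar> \<le> int r"
    then have "\<bar>real_of_int j\<bar> \<le> real r" by linarith
    then have cell: "\<bar>w\<bar> \<le> W" if "w \<in> cell \<alpha> j" for w
      using that unfolding cell_def W_def atLeastAtMost_iff by linarith
    have "z + h * w \<in> {z - \<delta><..<z + \<delta>}" if "w \<in> cell \<alpha> j" for w
    proof -
      have "\<bar>h * w\<bar> \<le> h * W" using h cell[OF that] by (simp add: abs_mult)
      then show ?thesis using h assms(2) by auto
    qed
    then have img: "(\<lambda>w. z + h * w) ` cell \<alpha> j \<subseteq> {z - \<delta><..<z + \<delta>}" by blast
    then have c: "continuous_on (cell \<alpha> j) (\<lambda>w. f (z + h * w))"
      by (intro continuous_on_compose2[OF cont]) (auto intro!: continuous_intros)
    let ?T = "taylor_poly N f z h"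
    have "datum kind z \<alpha> h f j - datum kind 0 \<alpha> 1 (poly ?T) j =
        datum kind 0 \<alpha> 1 (\<lambda>w. f (z + h * w) - poly ?T w) j"
      using datum_rescale[of h z \<alpha> j f kind] h continuous_on_subset[OF cont img]
        unit_datum_lincomb[OF c, of "poly ?T" kind 1 "-1"]
      by (simp add: continuous_on_poly)
    also have "\<bar>\<dots>\<bar> \<le> (M * W ^ N) * h ^ N"
      using c h cell
      by (intro unit_datum_bound approx continuous_on_diff continuous_on_poly) auto
    finally show "\<bar>datum kind z \<alpha> h f j - datum kind 0 \<alpha> 1 (poly ?T) j\<bar> \<le> (M * W ^ N) * h ^ N" .
  qed
  show ?thesis using \<open>W > 0\<close> M(1) by (intro that[OF _ ev]) simp
qed

section \<open>Reconstruction errors and the size of the smoothness indicators\<close>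

text \<open>Expansion in cardinal polynomials; the sum on the right is the Lebesgue constant of
  \<open>\<Phi>\<close>. The functional is kept abstract because it is later a point value, a value
  of the derivative, or a coefficient.\<close>

lemma reconstruction_functional_bound:
  fixes \<Phi> :: "real poly \<Rightarrow> real"
  assumes "m \<ge> 1" "\<And>p q. \<Phi> (p + q) = \<Phi> p + \<Phi> q" "\<And>b p. \<Phi> (smult b p) = b * \<Phi> p"
    "\<And>j. j \<in> {a..<a + int m} \<Longrightarrow> \<bar>u j - v j\<bar> \<le> E"
  shows "\<bar>\<Phi> (reconstruction_poly kind 0 \<alpha> 1 u a m) - \<Phi> (reconstruction_poly kind 0 \<alpha> 1 v a m)\<bar>
    \<le> E * (\<Sum>j\<in>{a..<a + int m}. \<bar>\<Phi> (cardinal_poly kind \<alpha> a m j)\<bar>)"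
proof -
  let ?A = "{a..<a + int m}" and ?L = "cardinal_poly kind \<alpha> a m"
  have "\<Phi> 0 = 0" using assms(3)[of 0 0] by simp
  have lin: "\<Phi> (\<Sum>j\<in>B. smult (w j) (?L j)) = (\<Sum>j\<in>B. w j * \<Phi> (?L j))" if "finite B" for w B
    using that by (induction B) (simp_all add: assms(2,3) \<open>\<Phi> 0 = 0\<close>)
  have "\<Phi> (reconstruction_poly kind 0 \<alpha> 1 u a m) - \<Phi> (reconstruction_poly kind 0 \<alpha> 1 v a m) =
      (\<Sum>j\<in>?A. (u j - v j) * \<Phi> (?L j))"
    by (simp add: unit_reconstruction_eq_sum[OF assms(1)] lin sum_subtractf algebra_simps)
  also have "\<bar>\<dots>\<bar> \<le> (\<Sum>j\<in>?A. E * \<bar>\<Phi> (?L j)\<bar>)"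
    using assms(4) by (intro order.trans[OF sum_abs] sum_mono) (simp add: abs_mult mult_right_mono)
  finally show ?thesis by (simp add: sum_distrib_left)
qed

lemma poly_reconstruction_node:
  assumes "h > 0" "m \<ge> 1"
  shows "poly (reconstruction_poly kind z \<alpha> h u a m) (node z \<alpha> h l) =
    poly (reconstruction_poly kind 0 \<alpha> 1 u a m) (\<alpha> + l)"
  using arg_cong[OF reconstruction_rescale[OF assms, of kind z \<alpha> u a], of "\<lambda>p. poly p (\<alpha> + l)"]
  by (simp add: poly_pcompose node_def mult.commute)

lemma unit_reconstruction_poly_data:
  assumes "m \<ge> 1" "degree p \<le> m - 1"
  shows "reconstruction_poly kind 0 \<alpha> 1 (datum kind 0 \<alpha> 1 (poly p)) a m = p"
  using assms by (intro unit_reconstruction_eqI) auto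

text \<open>The Taylor polynomial of degree at most \<open>2 * r - 2\<close> is reproduced exactly,
  so both \<open>f\<close> and \<open>p_h\<close> differ from it by
  \<open>O(h^(2r-1))\<close>.\<close>

lemma full_poly_error:
  assumes "Ck_on (2 * r - 1) f {z - \<delta><..<z + \<delta>}" "\<delta> > 0" "r \<ge> 1"
  obtains K where "\<forall>\<^sub>F h in at_right 0. \<bar>f (node z \<alpha> h (1/2))
    - poly (full_poly kind r z \<alpha> h (datum kind z \<alpha> h f)) (node z \<alpha> h (1/2))\<bar> \<le> K * h ^ (2 * r - 1)"
proof -
  let ?N = "2 * r - 1" and ?a = "- int r + 1"
  obtain M where M: "M \<ge> 0" "\<forall>\<^sub>F h in at_right 0.
    (\<forall>j. \<bar>j\<bar> \<le> int r \<longrightarrow> \<bar>datum kind z \<alpha> h f j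
      - datum kind 0 \<alpha> 1 (poly (taylor_poly ?N f z h)) j\<bar> \<le> M * h ^ ?N) \<and>
    \<bar>f (node z \<alpha> h (1/2)) - poly (taylor_poly ?N f z h) (\<alpha> + 1/2)\<bar> \<le> M * h ^ ?N"
    using datum_Taylor[OF assms(1,2), of r kind \<alpha>] assms(3) by auto
  define \<Lambda> where "\<Lambda> = (\<Sum>j\<in>{?a..<?a + int ?N}. \<bar>poly (cardinal_poly kind \<alpha> ?a ?N j) (\<alpha> + 1/2)\<bar>)"
  show ?thesis
  proof (rule that[of "M + M * \<Lambda>"], use M(2) eventually_at_right_less[of "0::real"] in eventually_elim)
    case (elim h)
    let ?T = "taylor_poly ?N f z h" and ?R = "\<lambda>u. reconstruction_poly kind 0 \<alpha> 1 u ?a ?N"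
    have "\<bar>poly (?R (datum kind z \<alpha> h f)) (\<alpha> + 1/2) -
        poly (?R (datum kind 0 \<alpha> 1 (poly ?T))) (\<alpha> + 1/2)\<bar> \<le> (M * h ^ ?N) * \<Lambda>"
      unfolding \<Lambda>_def
      by (rule reconstruction_functional_bound) (use assms(3) elim in auto)
    also have "?R (datum kind 0 \<alpha> 1 (poly ?T)) = ?T"
      using assms(3) degree_taylor_poly[of ?N f z h] by (intro unit_reconstruction_poly_data) auto
    finally have *: "\<bar>poly (?R (datum kind z \<alpha> h f)) (\<alpha> + 1/2) - poly ?T (\<alpha> + 1/2)\<bar>
        \<le> M * \<Lambda> * h ^ ?N"
      by (simp only: mult_ac)
    have "poly (full_poly kind r z \<alpha> h (datum kind z \<alpha> h f)) (node z \<alpha> h (1/2)) =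
        poly (?R (datum kind z \<alpha> h f)) (\<alpha> + 1/2)"
      unfolding full_poly_def using elim assms(3) by (intro poly_reconstruction_node) auto
    then show ?case
      using * elim(1)[THEN conjunct2] unfolding distrib_right by linarith
  qed
qed

text \<open>The Taylor polynomial of degree less than \<open>m\<close> is the constant
  \<open>f z\<close>, which is reproduced. The order comes from the flatness of \<open>f\<close> at
  \<open>z\<close>, so \<open>m\<close> may exceed \<open>r\<close>.\<close>

lemma sub_poly_near_const:
  assumes "Ck_on m f {z - \<delta><..<z + \<delta>}" "\<delta> > 0" "1 \<le> m" "i < r"
    "\<And>n. 1 \<le> n \<Longrightarrow> n < m \<Longrightarrow> (deriv ^^ n) f z = 0"
  shows "\<exists>K. \<forall>\<^sub>F h in at_right 0. \<bar>poly (sub_poly kind r z \<alpha> h (datum kind z \<alpha> h f) i)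
    (node z \<alpha> h (1/2)) - f z\<bar> \<le> K * h ^ m"
proof -
  let ?a = "- int r + 1 + int i"
  obtain M where M: "M \<ge> 0" "\<forall>\<^sub>F h in at_right 0.
    (\<forall>j. \<bar>j\<bar> \<le> int r \<longrightarrow> \<bar>datum kind z \<alpha> h f j
      - datum kind 0 \<alpha> 1 (poly (taylor_poly m f z h)) j\<bar> \<le> M * h ^ m) \<and>
    \<bar>f (node z \<alpha> h (1/2)) - poly (taylor_poly m f z h) (\<alpha> + 1/2)\<bar> \<le> M * h ^ m"
    using datum_Taylor[OF assms(1,2), of r kind \<alpha>] assms(3) by auto
  define \<Lambda> where "\<Lambda> = (\<Sum>j\<in>{?a..<?a + int r}. \<bar>poly (cardinal_poly kind \<alpha> ?a r j) (\<alpha> + 1/2)\<bar>)"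
  show ?thesis
  proof (rule exI[of _ "M * \<Lambda>"], use M(2) eventually_at_right_less[of "0::real"] in eventually_elim)
    case (elim h)
    let ?R = "\<lambda>u. reconstruction_poly kind 0 \<alpha> 1 u ?a r"
    have T: "taylor_poly m f z h = [:f z:]" using assms by (intro taylor_poly_eq_const) auto
    have "\<bar>poly (?R (datum kind z \<alpha> h f)) (\<alpha> + 1/2) -
        poly (?R (datum kind 0 \<alpha> 1 (poly [:f z:]))) (\<alpha> + 1/2)\<bar> \<le> (M * h ^ m) * \<Lambda>"
      unfolding \<Lambda>_def
      by (rule reconstruction_functional_bound) (use assms elim T in auto)
    also have "?R (datum kind 0 \<alpha> 1 (poly [:f z:])) = [:f z:]"
      using assms by (intro unit_reconstruction_poly_data) auto
    finally show ?case
      using elim assms by (simp add: sub_poly_def poly_reconstruction_node algebra_simps)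
  qed
qed

text \<open>In the variable \<open>w\<close>, \<open>p_i\<close> is \<open>f z + t h^m G\<close> up
  to \<open>O(h^(m+1))\<close>, where \<open>G\<close> reconstructs \<open>w^m\<close> and is not
  constant. The squared derivative thus integrates to at least
  \<open>t^2 h^(2m) J / 2 - O(h^(2m+2))\<close>.\<close>

lemma smoothness_indicator_lower_bound:
  assumes "Ck_on (Suc m) f {z - \<delta><..<z + \<delta>}" "\<delta> > 0" "1 \<le> m" "i < r" "r \<ge> 3"
    "\<And>n. 1 \<le> n \<Longrightarrow> n < m \<Longrightarrow> (deriv ^^ n) f z = 0" "(deriv ^^ m) f z \<noteq> 0"
  shows "\<exists>K. \<forall>\<^sub>F h in at_right 0.
    0 < smoothness_indicator kind r z \<alpha> h (datum kind z \<alpha> h f) i \<and>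
    h ^ (2 * m) \<le> K * smoothness_indicator kind r z \<alpha> h (datum kind z \<alpha> h f) i"
proof -
  let ?a = "- int r + 1 + int i" and ?R = "\<lambda>u. reconstruction_poly kind 0 \<alpha> 1 u (- int r + 1 + int i) r"
  let ?L = "cardinal_poly kind \<alpha> ?a r" and ?A = "{?a..<?a + int r}"
  define t where "t = (deriv ^^ m) f z / fact m"
  define G where "G = ?R (datum kind 0 \<alpha> 1 (poly (monom 1 m)))"
  define J where "J = integral (cell \<alpha> 0) (\<lambda>w. (poly (pderiv G) w)\<^sup>2)"
  have "J > 0"
    unfolding J_def G_def using assms
    by (intro integral_cell_poly_square_pos unit_reconstruction_monom_nonconst) auto
  have "t \<noteq> 0" using assms by (simp add: t_def)
  obtain M where M: "M \<ge> 0" "\<forall>\<^sub>F h in at_right 0.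
    (\<forall>j. \<bar>j\<bar> \<le> int r \<longrightarrow> \<bar>datum kind z \<alpha> h f j
      - datum kind 0 \<alpha> 1 (poly (taylor_poly (Suc m) f z h)) j\<bar> \<le> M * h ^ Suc m) \<and>
    \<bar>f (node z \<alpha> h (1/2)) - poly (taylor_poly (Suc m) f z h) (\<alpha> + 1/2)\<bar> \<le> M * h ^ Suc m"
    using datum_Taylor[OF assms(1,2), of r kind \<alpha>] by auto
  have "bounded ((\<lambda>w. \<Sum>j\<in>?A. \<bar>poly (pderiv (?L j)) w\<bar>) ` cell \<alpha> 0)"
    unfolding cell_def
    by (intro compact_imp_bounded compact_continuous_image) (auto intro!: continuous_intros)
  then obtain B where B: "\<And>w. w \<in> cell \<alpha> 0 \<Longrightarrow> (\<Sum>j\<in>?A. \<bar>poly (pderiv (?L j)) w\<bar>) \<le> B"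
    unfolding bounded_iff by (metis abs_le_D1 imageI real_norm_def)
  have "((\<lambda>h. (M * B)\<^sup>2 * h\<^sup>2) \<longlongrightarrow> (M * B)\<^sup>2 * 0\<^sup>2) (at_right 0)"
    by (intro tendsto_intros)
  \<comment> \<open>For such \<open>h\<close> the perturbation uses up at most half of the leading
    term; \<open>t^2 J / 4\<close> remains, whose reciprocal is the witness below.\<close>
  then have small: "\<forall>\<^sub>F h in at_right 0. (M * B)\<^sup>2 * h\<^sup>2 < t\<^sup>2 / 4 * J"
    using \<open>J > 0\<close> \<open>t \<noteq> 0\<close> by (intro order_tendstoD(2)) auto
  show ?thesis
  proof (rule exI[of _ "4 / (t\<^sup>2 * J)"],
      use M(2) small eventually_at_right_less[of "0::real"] in eventually_elim)
    case (elim h)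
    let ?u = "datum kind z \<alpha> h f"
    let ?T = "[:f z:] + monom (t * h ^ m) m"
    have T: "taylor_poly (Suc m) f z h = ?T"
      using taylor_poly_eq_const[OF assms(6,3), where h = h]
      by (simp add: taylor_poly_Suc t_def)
    \<comment> \<open>As \<open>m\<close> may exceed \<open>r - 1\<close>, \<open>?T\<close> itself
      need not be reproduced; its monomial is replaced by \<open>G\<close>, which has the same data
      on the substencil.\<close>
    have RT: "?R (datum kind 0 \<alpha> 1 (poly ?T)) = [:f z:] + smult (t * h ^ m) G"
    proof (rule unit_reconstruction_eqI)
      show "1 \<le> r" using assms by simp
      then show "degree ([:f z:] + smult (t * h ^ m) G) \<le> r - 1"
        using unit_reconstruction(1)[of r kind \<alpha> _ ?a]
        by (intro degree_add_le order.trans[OF degree_smult_le]) (auto simp: G_def)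
      fix j assume j: "j \<in> ?A"
      have "datum kind 0 \<alpha> 1 (poly ([:f z:] + smult b p)) j =
          datum kind 0 \<alpha> 1 (poly [:f z:]) j + b * datum kind 0 \<alpha> 1 (poly p) j" for b p
        using unit_datum_lincomb[of \<alpha> j "poly [:f z:]" "poly p" kind 1 b]
        by (simp add: continuous_on_poly del: poly_pCons flip: poly_add poly_smult)
      from this[of "t * h ^ m" "monom 1 m"] this[of "t * h ^ m" G]
      show "datum kind 0 \<alpha> 1 (poly ([:f z:] + smult (t * h ^ m) G)) j = datum kind 0 \<alpha> 1 (poly ?T) j"
        using unit_reconstruction(2)[of r j ?a kind \<alpha>] j assms
        by (simp add: G_def smult_monom)
    qed
    have "\<bar>poly (pderiv (?R ?u)) w - (t * h ^ m) * poly (pderiv G) w\<bar> \<le> (M * h ^ Suc m) * B"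
      if w: "w \<in> cell \<alpha> 0" for w
    proof -
      have "\<bar>poly (pderiv (?R ?u)) w - poly (pderiv (?R (datum kind 0 \<alpha> 1 (poly ?T)))) w\<bar>
          \<le> (M * h ^ Suc m) * (\<Sum>j\<in>?A. \<bar>poly (pderiv (?L j)) w\<bar>)"
        by (rule reconstruction_functional_bound[where \<Phi> = "\<lambda>p. poly (pderiv p) w"])
          (use assms elim T in \<open>auto simp: pderiv_add pderiv_smult\<close>)
      also have "\<dots> \<le> (M * h ^ Suc m) * B"
        using B[OF w] M(1) elim by (intro mult_left_mono) auto
      finally show ?thesis unfolding RT by (simp add: pderiv_add pderiv_smult pderiv_pCons)
    qed
    then have "(t * h ^ m)\<^sup>2 / 2 * J - ((M * h ^ Suc m) * B)\<^sup>2 \<le>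
        integral (cell \<alpha> 0) (\<lambda>w. (poly (pderiv (?R ?u)) w)\<^sup>2)"
      unfolding J_def by (intro integral_square_perturbation continuous_on_poly) auto
    also have "\<dots> \<le> smoothness_indicator kind r z \<alpha> h ?u i"
      using assms elim by (intro smoothness_indicator_ge) auto
    finally have "(t * h ^ m)\<^sup>2 / 2 * J - ((M * h ^ Suc m) * B)\<^sup>2 \<le>
      smoothness_indicator kind r z \<alpha> h ?u i" .
    moreover have "(t * h ^ m)\<^sup>2 / 2 * J - ((M * h ^ Suc m) * B)\<^sup>2 =
        h ^ (2 * m) * (t\<^sup>2 / 2 * J - (M * B)\<^sup>2 * h\<^sup>2)"
      by (simp add: power_mult_distrib power_mult power2_eq_square power_add algebra_simps)
    moreover have "h ^ (2 * m) * (t\<^sup>2 / 4 * J) \<le> h ^ (2 * m) * (t\<^sup>2 / 2 * J - (M * B)\<^sup>2 * h\<^sup>2)"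
    proof (rule mult_left_mono)
      show "t\<^sup>2 / 4 * J \<le> t\<^sup>2 / 2 * J - (M * B)\<^sup>2 * h\<^sup>2" using elim(2) by linarith
    qed (use elim in simp)
    ultimately have *: "h ^ (2 * m) * (t\<^sup>2 / 4 * J) \<le> smoothness_indicator kind r z \<alpha> h ?u i"
      by linarith
    have "0 < h ^ (2 * m) * (t\<^sup>2 / 4 * J)" using \<open>t \<noteq> 0\<close> \<open>J > 0\<close> elim by simp
    moreover have "h ^ (2 * m) = 4 / (t\<^sup>2 * J) * (h ^ (2 * m) * (t\<^sup>2 / 4 * J))"
      using \<open>t \<noteq> 0\<close> \<open>J > 0\<close> by simp
    moreover have "\<dots> \<le> 4 / (t\<^sup>2 * J) * smoothness_indicator kind r z \<alpha> h ?u i"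
      using * \<open>J > 0\<close> by (intro mult_left_mono) auto
    ultimately show ?case using * by linarith
  qed
qed

section \<open>Upper bounds for \<open>d1\<close> and \<open>d2\<close>\<close>

text \<open>The difference of order \<open>2 * r - 2\<close> annihilates the Taylor polynomial of
  lower degree; only remainders of size \<open>h^(2r-2)\<close> are left, and they get
  squared.\<close>

lemma d1_bound:
  assumes "Ck_on (2 * r - 2) f {z - \<delta><..<z + \<delta>}" "\<delta> > 0" "r \<ge> 2"
  obtains K where "\<forall>\<^sub>F h in at_right 0. d1 r (datum kind z \<alpha> h f) \<le> K * h ^ (4 * r - 4)"
proof -
  let ?N = "2 * r - 2" and ?a = "- int r + 1"
  obtain M where M: "M \<ge> 0" "\<forall>\<^sub>F h in at_right 0.
    (\<forall>j. \<bar>j\<bar> \<le> int r \<longrightarrow> \<bar>datum kind z \<alpha> h f j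
      - datum kind 0 \<alpha> 1 (poly (taylor_poly ?N f z h)) j\<bar> \<le> M * h ^ ?N) \<and>
    \<bar>f (node z \<alpha> h (1/2)) - poly (taylor_poly ?N f z h) (\<alpha> + 1/2)\<bar> \<le> M * h ^ ?N"
    using datum_Taylor[OF assms(1,2), of r kind \<alpha>] assms(3) by auto
  define S where "S = (\<Sum>k\<le>?N. real (?N choose k))"
  show ?thesis
  proof (rule that[of "(S * M)\<^sup>2"], use M(2) eventually_at_right_less[of "0::real"] in eventually_elim)
    case (elim h)
    let ?u = "datum kind z \<alpha> h f" and ?v = "datum kind 0 \<alpha> 1 (poly (taylor_poly ?N f z h))"
    have "degree (taylor_poly ?N f z h) < ?N"
      using degree_taylor_poly[of ?N f z h] assms(3) by linarith
    then have "(\<Sum>k\<le>?N. (- 1) ^ k * real (?N choose k) * ?u (?a + int k)) =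
        (\<Sum>k\<le>?N. (- 1) ^ k * real (?N choose k) * (?u (?a + int k) - ?v (?a + int k)))"
      using finite_difference_poly_data[of "taylor_poly ?N f z h" ?N kind \<alpha> ?a]
      by (simp add: right_diff_distrib sum_subtractf)
    also have "\<bar>\<dots>\<bar> \<le> (\<Sum>k\<le>?N. real (?N choose k) * (M * h ^ ?N))"
      using elim assms(3)
      by (intro order.trans[OF sum_abs] sum_mono) (auto simp: abs_mult intro!: mult_left_mono)
    also have "\<dots> = S * (M * h ^ ?N)" by (simp add: S_def sum_distrib_right)
    finally have "\<bar>\<Sum>k\<le>?N. (- 1) ^ k * real (?N choose k) * ?u (?a + int k)\<bar> \<le> S * (M * h ^ ?N)" .
    from power_mono[OF this abs_ge_zero, of 2]
    have "(\<Sum>k\<le>?N. (- 1) ^ k * real (?N choose k) * ?u (?a + int k))\<^sup>2 \<le> (S * (M * h ^ ?N))\<^sup>2"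
      by (simp only: power2_abs)
    also have "\<dots> = (S * M)\<^sup>2 * h ^ (4 * r - 4)"
      using assms(3) by (simp add: power_mult_distrib diff_mult_distrib flip: power_mult)
    finally show ?case using d1_eq[of r ?u] assms(3) by simp
  qed
qed

lemma eventually_at_right_0_small: "\<forall>\<^sub>F h in at_right (0::real). 0 < h \<and> h < 1"
  by (auto simp: eventually_at_right_field intro!: exI[of _ 1])

text \<open>
  Here \<open>A\<^sub>h = O(h\<^bsup>2r-2\<^esup>)\<close>, while \<open>B\<^sub>h\<close> and \<open>C\<^sub>h\<close> are \<open>O(h\<^bsup>2r-1\<^esup>)\<close>.
\<close>

lemma d2_bound:
  assumes "Ck_on (2 * r - 1) f {z - \<delta><..<z + \<delta>}" "\<delta> > 0" "r \<ge> 3"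
    "\<And>n. 1 \<le> n \<Longrightarrow> n < 2 * r - 2 \<Longrightarrow> (deriv ^^ n) f z = 0"
  obtains K where "\<forall>\<^sub>F h in at_right 0. \<bar>d2 kind r z \<alpha> h (datum kind z \<alpha> h f)\<bar> \<le> K * h ^ (4 * r - 3)"
proof -
  let ?N = "2 * r - 1" and ?a = "- int r + 1" and ?m = "2 * r - 2"
  have Suc: "Suc ?m = ?N" using assms(3) by simp
  let ?R = "\<lambda>u. reconstruction_poly kind 0 \<alpha> 1 u ?a ?N"
  define t where "t = (deriv ^^ ?m) f z / fact ?m"
  obtain M where M: "M \<ge> 0" "\<forall>\<^sub>F h in at_right 0.
    (\<forall>j. \<bar>j\<bar> \<le> int r \<longrightarrow> \<bar>datum kind z \<alpha> h f j
      - datum kind 0 \<alpha> 1 (poly (taylor_poly ?N f z h)) j\<bar> \<le> M * h ^ ?N) \<and>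
    \<bar>f (node z \<alpha> h (1/2)) - poly (taylor_poly ?N f z h) (\<alpha> + 1/2)\<bar> \<le> M * h ^ ?N"
    using datum_Taylor[OF assms(1,2), of r kind \<alpha>] assms(3) by auto
  define \<Lambda> where "\<Lambda> n = (\<Sum>j\<in>{?a..<?a + int ?N}. \<bar>coeff (cardinal_poly kind \<alpha> ?a ?N j) n\<bar>)" for n
  have \<Lambda>: "\<Lambda> n \<ge> 0" for n by (simp add: \<Lambda>_def sum_nonneg)
  define K where "K = M * (\<Lambda> ?m + \<Lambda> (1 + (2 * r - 4)) + \<Lambda> (2 * r - 4))"
  have "K \<ge> 0" using M(1) \<Lambda> by (simp add: K_def)
  \<comment> \<open>\<open>b k\<close> is the factor produced by differentiating
    \<open>w^(k + 2r - 4)\<close> exactly \<open>2 * r - 4\<close> times.\<close>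
  define b where "b k = pochhammer (real (Suc k)) (2 * r - 4)" for k
  show ?thesis
  proof (rule that[of "(b 1 * K)\<^sup>2 + 4 * \<bar>b 2 * b 0\<bar> * ((\<bar>t\<bar> + K) * K)"],
      use M(2) eventually_at_right_0_small in eventually_elim)
    case (elim h)
    let ?u = "datum kind z \<alpha> h f"
    let ?T = "[:f z:] + monom (t * h ^ ?m) ?m"
    let ?x = "\<lambda>n. coeff (?R ?u) n"
    have T: "taylor_poly ?N f z h = ?T"
      using taylor_poly_eq_const[OF assms(4), where h = h] assms(3)
      unfolding Suc[symmetric] by (simp add: taylor_poly_Suc t_def)
    have RT: "?R (datum kind 0 \<alpha> 1 (poly ?T)) = ?T"
      unfolding T[symmetric] using assms(3) degree_taylor_poly[of ?N f z h]
      by (intro unit_reconstruction_poly_data) auto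
    have x: "\<bar>?x n - coeff ?T n\<bar> \<le> M * \<Lambda> n * h ^ ?N" for n
    proof -
      have "\<bar>?x n - coeff (?R (datum kind 0 \<alpha> 1 (poly ?T))) n\<bar> \<le> (M * h ^ ?N) * \<Lambda> n"
        unfolding \<Lambda>_def
        by (rule reconstruction_functional_bound) (use assms(3) elim T in auto)
      then show ?thesis unfolding RT by (simp only: mult_ac)
    qed
    have "M * \<Lambda> n * h ^ ?N \<le> K * h ^ ?N" if "n \<in> {?m, 1 + (2 * r - 4), 2 * r - 4}" for n
      using that \<Lambda> M(1) elim unfolding K_def
      by (intro mult_right_mono mult_left_mono) (auto simp: add_increasing add_increasing2)
    then have xK: "\<bar>?x n - coeff ?T n\<bar> \<le> K * h ^ ?N"
      if "n \<in> {?m, 1 + (2 * r - 4), 2 * r - 4}" for n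
      using order.trans[OF x] that by blast
    have T0: "coeff ?T n = 0" if "n \<noteq> 0" "n \<noteq> ?m" for n
      using that by (simp add: coeff_pCons split: nat.split)
    \<comment> \<open>Because \<open>r \<ge> 3\<close>, the indices \<open>2r - 4\<close> and
      \<open>2r - 3\<close> lie strictly between 0 and \<open>2r - 2\<close>, where the coefficients
      of \<open>?T\<close> vanish.\<close>
    have x01: "\<bar>?x (2 * r - 4)\<bar> \<le> K * h ^ ?N" "\<bar>?x (1 + (2 * r - 4))\<bar> \<le> K * h ^ ?N"
      using xK[of "2 * r - 4"] xK[of "1 + (2 * r - 4)"] T0[of "2 * r - 4"] T0[of "1 + (2 * r - 4)"]
        assms(3) by (simp_all only: insert_iff simp_thms) auto
    have "coeff ?T ?m = t * h ^ ?m"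
      using assms(3) by (auto simp: coeff_pCons split: nat.splits)
    then have "\<bar>?x ?m\<bar> \<le> \<bar>t * h ^ ?m\<bar> + K * h ^ ?N" using xK[of ?m] unfolding insert_iff by linarith
    also have "\<dots> \<le> \<bar>t\<bar> * h ^ ?m + K * h ^ ?m"
      using elim \<open>K \<ge> 0\<close> by (intro add_mono mult_left_mono power_decreasing) (auto simp: abs_mult)
    finally have x2: "\<bar>?x ?m\<bar> \<le> (\<bar>t\<bar> + K) * h ^ ?m" by (simp add: distrib_right)
    have coeffs: "coeff ((pderiv ^^ (2 * r - 4)) (?R ?u)) k = b k * ?x (k + (2 * r - 4))" for k
      by (simp add: coeff_higher_pderiv b_def)
    have idx: "2 + (2 * r - 4) = ?m" using assms(3) by simp
    have "d2 kind r z \<alpha> h ?u =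
        (b 1 * ?x (1 + (2 * r - 4)))\<^sup>2 - 4 * (b 2 * ?x ?m) * (b 0 * ?x (2 * r - 4))"
      using reconstruction_rescale[of h ?N kind z \<alpha> ?u ?a] elim assms(3)
      by (simp only: d2_def Let_def full_poly_def coeffs idx) simp
    also have "\<bar>\<dots>\<bar> \<le> (b 1 * (K * h ^ ?N))\<^sup>2 + 4 * \<bar>b 2 * b 0\<bar> * (((\<bar>t\<bar> + K) * h ^ ?m) * (K * h ^ ?N))"
    proof -
      have "\<bar>b 1 * ?x (1 + (2 * r - 4))\<bar>\<^sup>2 \<le> (\<bar>b 1\<bar> * (K * h ^ ?N))\<^sup>2"
        using x01(2) by (intro power_mono) (auto simp: abs_mult intro!: mult_left_mono)
      also have "\<dots> = (b 1 * (K * h ^ ?N))\<^sup>2" by (simp add: power_mult_distrib)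
      finally have 1: "\<bar>(b 1 * ?x (1 + (2 * r - 4)))\<^sup>2\<bar> \<le> (b 1 * (K * h ^ ?N))\<^sup>2"
        by (simp only: power2_abs abs_power2)
      have "\<bar>4 * (b 2 * ?x ?m) * (b 0 * ?x (2 * r - 4))\<bar> =
          4 * \<bar>b 2 * b 0\<bar> * (\<bar>?x ?m\<bar> * \<bar>?x (2 * r - 4)\<bar>)"
        by (simp add: abs_mult mult_ac)
      also have "\<dots> \<le> 4 * \<bar>b 2 * b 0\<bar> * (((\<bar>t\<bar> + K) * h ^ ?m) * (K * h ^ ?N))"
        using x01(1) x2 elim \<open>K \<ge> 0\<close> by (intro mult_left_mono mult_mono) auto
      finally show ?thesis by (rule order.trans[OF abs_triangle_ineq4 add_mono[OF 1]])
    qed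
    also have "\<dots> = (b 1 * K)\<^sup>2 * h ^ (?N + ?N) + 4 * \<bar>b 2 * b 0\<bar> * ((\<bar>t\<bar> + K) * K) * h ^ (?m + ?N)"
      by (simp only: power_add power2_eq_square mult_ac)
    \<comment> \<open>The exponents are \<open>4r - 2\<close> and \<open>4r - 3\<close>; as
      \<open>h < 1\<close>, the smaller one dominates.\<close>
    also have "\<dots> \<le> (b 1 * K)\<^sup>2 * h ^ (4 * r - 3) + 4 * \<bar>b 2 * b 0\<bar> * ((\<bar>t\<bar> + K) * K) * h ^ (4 * r - 3)"
      using elim \<open>K \<ge> 0\<close> assms(3)
      by (intro add_mono mult_left_mono power_decreasing) auto
    finally show ?case by (simp only: distrib_right)
  qed
qed

section \<open>The weights\<close>

text \<open>From \<open>ln (1 + \<rho>) \<le> \<rho>\<close> and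
  \<open>exp x - 1 \<le> x * exp x\<close>. This treats all \<open>s > 0\<close> alike; the bound
  \<open>B\<close> turns the exponential into a constant.\<close>

lemma powr_one_plus_le:
  fixes s \<rho> B :: real
  assumes "0 \<le> \<rho>" "\<rho> \<le> B" "0 < s"
  shows "(1 + \<rho>) powr s \<le> 1 + s * exp (s * B) * \<rho>"
proof -
  have "(1 + \<rho>) powr s = exp (s * ln (1 + \<rho>))" using assms by (simp add: powr_def)
  also have "\<dots> \<le> exp (s * \<rho>)"
    using assms ln_add_one_self_le_self[of \<rho>] by simp
  also have "\<dots> \<le> 1 + s * \<rho> * exp (s * \<rho>)"
  proof -
    have "1 - s * \<rho> \<le> exp (- (s * \<rho>))" using exp_ge_add_one_self[of "- (s * \<rho>)"] by simp
    then have "(1 - s * \<rho>) * exp (s * \<rho>) \<le> exp (- (s * \<rho>)) * exp (s * \<rho>)"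
      by (rule mult_right_mono) simp
    then show ?thesis by (simp add: algebra_simps exp_minus)
  qed
  also have "\<dots> \<le> 1 + s * \<rho> * exp (s * B)"
    using assms by (simp add: mult_left_mono)
  finally show ?thesis by (simp add: mult_ac)
qed

text \<open>Both \<open>\<gamma> i\<close> and the convex combination \<open>?S\<close> lie between
  1 and \<open>1 + H\<close>, so they differ by at most \<open>H\<close>, and dividing by
  \<open>?S \<ge> 1\<close> does no harm.\<close>

lemma normalized_weight_close:
  fixes c \<gamma> :: "nat \<Rightarrow> real"
  assumes "\<And>i. i < r \<Longrightarrow> c i > 0" "(\<Sum>i<r. c i) = 1"
    "\<And>i. i < r \<Longrightarrow> 1 \<le> \<gamma> i" "\<And>i. i < r \<Longrightarrow> \<gamma> i \<le> 1 + H" "i < r"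
  shows "\<bar>c i * \<gamma> i / (\<Sum>k<r. c k * \<gamma> k) - c i\<bar> \<le> c i * H"
proof -
  let ?S = "\<Sum>k<r. c k * \<gamma> k"
  have "(\<Sum>k<r. c k * 1) \<le> ?S" "?S \<le> (\<Sum>k<r. c k * (1 + H))"
    by (intro sum_mono mult_left_mono; use assms(1,3,4) in \<open>force intro: less_imp_le\<close>)+
  then have S: "1 \<le> ?S" "?S \<le> 1 + H"
    using assms(2) by (simp_all flip: sum_distrib_right)
  have eq: "c i * \<gamma> i / ?S - c i = c i * ((\<gamma> i - ?S) / ?S)" using S(1) by (simp add: field_simps)
  have "\<bar>(\<gamma> i - ?S) / ?S\<bar> \<le> H / 1"
    using S assms(3)[OF assms(5)] assms(4)[OF assms(5)]
    unfolding abs_divide by (intro frac_le) auto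
  then have "\<bar>c i * ((\<gamma> i - ?S) / ?S)\<bar> \<le> c i * H"
    using assms(1)[OF assms(5)] unfolding abs_mult by (intro mult_mono) auto
  then show ?thesis by (simp only: eq)
qed

text \<open>A quotient \<open>x y / (x + y + \<epsilon>)\<close> is at most each of its factors,
  whatever \<open>\<epsilon>\<close> is. Which of the two bounds is used depends on
  \<open>m\<close>.\<close>

lemma oweno_d_bounds:
  assumes "\<epsilon> > 0"
  shows "0 \<le> oweno_d kind r z \<alpha> s1 \<epsilon> h u"
    and "oweno_d kind r z \<alpha> s1 \<epsilon> h u \<le> d1 r u powr s1"
    and "oweno_d kind r z \<alpha> s1 \<epsilon> h u \<le> \<bar>d2 kind r z \<alpha> h u\<bar> powr s1"
proof -
  define x y where "x = d1 r u powr s1" and "y = \<bar>d2 kind r z \<alpha> h u\<bar> powr s1"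
  have nn: "x \<ge> 0" "y \<ge> 0" by (simp_all add: x_def y_def)
  have eq: "oweno_d kind r z \<alpha> s1 \<epsilon> h u = x * y / (x + y + \<epsilon>)"
    by (simp add: oweno_d_def x_def y_def)
  show "0 \<le> oweno_d kind r z \<alpha> s1 \<epsilon> h u" using nn assms by (simp add: eq)
  have "x * y \<le> x * (x + y + \<epsilon>)" "y * x \<le> y * (x + y + \<epsilon>)"
    using nn assms by (auto intro!: mult_left_mono)
  then show "oweno_d kind r z \<alpha> s1 \<epsilon> h u \<le> d1 r u powr s1"
    "oweno_d kind r z \<alpha> s1 \<epsilon> h u \<le> \<bar>d2 kind r z \<alpha> h u\<bar> powr s1"
    using nn assms unfolding eq x_def[symmetric] y_def[symmetric]
    by (simp_all add: pos_divide_le_eq mult.commute)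
qed

lemma oweno_factor_ge_1:
  assumes "\<epsilon> > 0" "s2 > 0"
  shows "1 \<le> (1 + oweno_d kind r z \<alpha> s1 \<epsilon> h u / (I powr s1 + \<epsilon>)) powr s2"
proof -
  have "0 \<le> oweno_d kind r z \<alpha> s1 \<epsilon> h u / (I powr s1 + \<epsilon>)"
    using oweno_d_bounds(1)[OF assms(1)] assms(1) by (simp add: add_nonneg_nonneg)
  then show ?thesis using assms(2) by (intro ge_one_powr_ge_zero) auto
qed

text \<open>The power of \<open>I\<close> cancels against the denominator, which
  \<open>\<epsilon>\<close> only enlarges; hence the bound is free of
  \<open>\<epsilon>\<close>.\<close>

lemma oweno_factor_le:
  assumes "\<epsilon> > 0" "s2 > 0" "s1 \<ge> 1" "I > 0" "B \<ge> 0" "0 < h" "h < 1"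
    and "d1 r u \<le> B * h ^ k * I \<or> \<bar>d2 kind r z \<alpha> h u\<bar> \<le> B * h ^ k * I"
  shows "(1 + oweno_d kind r z \<alpha> s1 \<epsilon> h u / (I powr s1 + \<epsilon>)) powr s2
    \<le> 1 + s2 * exp (s2 * B powr s1) * B powr s1 * h ^ k"
proof -
  let ?\<rho> = "oweno_d kind r z \<alpha> s1 \<epsilon> h u / (I powr s1 + \<epsilon>)"
  have hk: "0 < h ^ k" "h ^ k \<le> 1" using assms by (auto intro: power_le_one)
  have "d1 r u \<ge> 0" by (simp add: d1_def)
  have "oweno_d kind r z \<alpha> s1 \<epsilon> h u \<le> (B * h ^ k * I) powr s1"
    using assms(8)
  proof
    assume "d1 r u \<le> B * h ^ k * I"
    then have "d1 r u powr s1 \<le> (B * h ^ k * I) powr s1"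
      using assms \<open>d1 r u \<ge> 0\<close> by (intro powr_mono2) auto
    then show ?thesis using oweno_d_bounds(2)[OF assms(1)] order.trans by blast
  next
    assume "\<bar>d2 kind r z \<alpha> h u\<bar> \<le> B * h ^ k * I"
    then have "\<bar>d2 kind r z \<alpha> h u\<bar> powr s1 \<le> (B * h ^ k * I) powr s1"
      using assms by (intro powr_mono2) auto
    then show ?thesis using oweno_d_bounds(3)[OF assms(1)] order.trans by blast
  qed
  also have "(B * h ^ k * I) powr s1 = B powr s1 * (h ^ k) powr s1 * I powr s1"
    using assms hk by (simp add: powr_mult)
  \<comment> \<open>Here \<open>s1 \<ge> 1\<close> enters: \<open>h ^ k \<le> 1\<close>, so raising
    it to the power \<open>s1\<close> does not increase it.\<close>
  also have "\<dots> \<le> B powr s1 * h ^ k * I powr s1"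
    using powr_mono'[of 1 s1 "h ^ k"] hk assms(3)
    by (intro mult_right_mono mult_left_mono) auto
  also have "\<dots> \<le> B powr s1 * h ^ k * (I powr s1 + \<epsilon>)"
    using assms hk by (intro mult_left_mono) auto
  finally have \<rho>: "?\<rho> \<le> B powr s1 * h ^ k"
    using assms(1) by (simp add: pos_divide_le_eq add_nonneg_pos)
  also have "\<dots> \<le> B powr s1" using hk by (intro mult_right_le_one_le) auto
  finally have \<rho>B: "?\<rho> \<le> B powr s1" .
  have "?\<rho> \<ge> 0"
    using oweno_d_bounds(1)[OF assms(1)] assms(1) by (simp add: add_nonneg_nonneg)
  then have "(1 + ?\<rho>) powr s2 \<le> 1 + s2 * exp (s2 * B powr s1) * ?\<rho>"
    using \<rho>B assms(2) by (rule powr_one_plus_le)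
  also have "\<dots> \<le> 1 + s2 * exp (s2 * B powr s1) * (B powr s1 * h ^ k)"
    using \<rho> assms(2) by (intro add_left_mono mult_left_mono) auto
  finally show ?thesis by (simp add: mult.assoc)
qed

text \<open>Finitely many indices and monotonicity in the constant: the sum of the absolute values
  of all constants serves every index.\<close>

lemma eventually_uniform_const:
  fixes P :: "nat \<Rightarrow> real \<Rightarrow> 'a \<Rightarrow> bool"
  assumes "\<And>i. i < r \<Longrightarrow> \<exists>K. \<forall>\<^sub>F h in F. P i K h"
    "\<And>i K K' h. P i K h \<Longrightarrow> K \<le> K' \<Longrightarrow> P i K' h"
  obtains K where "K \<ge> 0" "\<forall>\<^sub>F h in F. \<forall>i<r. P i K h"
proof -
  obtain \<kappa> where \<kappa>: "\<And>i. i < r \<Longrightarrow> \<forall>\<^sub>F h in F. P i (\<kappa> i) h"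
    using assms(1) by metis
  define K where "K = (\<Sum>i<r. \<bar>\<kappa> i\<bar>)"
  have le: "\<kappa> i \<le> K" if "i < r" for i
    using member_le_sum[of i "{..<r}" "\<lambda>i. \<bar>\<kappa> i\<bar>"] that by (auto simp: K_def)
  have "\<forall>\<^sub>F h in F. P i K h" if "i < r" for i
    by (rule eventually_mono[OF \<kappa>[OF that]]) (rule assms(2)[OF _ le[OF that]])
  then have "\<forall>\<^sub>F h in F. \<forall>i\<in>{..<r}. P i K h" by (intro eventually_ball_finite) auto
  then show ?thesis by (intro that[of K]) (auto simp: Ball_def K_def sum_nonneg)
qed

lemma oweno_weight_eq:
  "oweno_weight kind r z \<alpha> c s1 s2 \<epsilon> h u i =
    c i * (1 + oweno_d kind r z \<alpha> s1 \<epsilon> h u / (smoothness_indicator kind r z \<alpha> h u i powr s1 + \<epsilon>)) powr s2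
    / (\<Sum>k<r. c k * (1 + oweno_d kind r z \<alpha> s1 \<epsilon> h u /
        (smoothness_indicator kind r z \<alpha> h u k powr s1 + \<epsilon>)) powr s2)"
  by (simp add: oweno_weight_def unnormalized_weight_def)

text \<open>The weights form a convex combination. The crude bound 1 suffices when the derivatives
  of orders 1 to \<open>2 * r - 2\<close> all vanish at \<open>z\<close>.\<close>

lemma oweno_weights:
  assumes "\<And>i. i < r \<Longrightarrow> c i > 0" "(\<Sum>i<r. c i) = 1" "\<epsilon> > 0" "s2 > 0" "r \<ge> 1"
  shows "(\<Sum>i<r. oweno_weight kind r z \<alpha> c s1 s2 \<epsilon> h u i) = 1"
    and "i < r \<Longrightarrow> \<bar>oweno_weight kind r z \<alpha> c s1 s2 \<epsilon> h u i - c i\<bar> \<le> 1"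
proof -
  let ?w = "oweno_weight kind r z \<alpha> c s1 s2 \<epsilon> h u" and ?a = "unnormalized_weight kind r z \<alpha> c s1 s2 \<epsilon> h u"
  have pos: "?a i > 0" if "i < r" for i
    using assms(1)[OF that] oweno_factor_ge_1[OF assms(3,4), of kind r z \<alpha> s1 h u]
    unfolding unnormalized_weight_def by (meson less_le_trans mult_pos_pos zero_less_one)
  then have S: "(\<Sum>k<r. ?a k) > 0" using assms(5) by (intro sum_pos) (auto simp: lessThan_empty_iff)
  then show sum1: "(\<Sum>i<r. ?w i) = 1"
    by (simp add: oweno_weight_def flip: sum_divide_distrib)
  have w: "?w k \<ge> 0" if "k < r" for k
    using pos[OF that] S by (simp add: oweno_weight_def)
  assume i: "i < r"
  have "?w i \<le> 1" "c i \<le> 1"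
    using member_le_sum[of i "{..<r}" ?w] member_le_sum[of i "{..<r}" c] i w sum1 assms(1,2)
    by (auto simp: less_imp_le)
  then show "\<bar>?w i - c i\<bar> \<le> 1" using w[OF i] assms(1)[OF i] by linarith
qed

section \<open>Assembly of the error bound\<close>

text \<open>The order \<open>k\<close> of the weights and the order \<open>m\<close> of
  \<open>p_i - f z\<close> multiply to \<open>h^(m + k)\<close>. Keeping both as parameters lets the
  degenerate case \<open>m = 2 * r - 1\<close>, \<open>k = 0\<close> share the argument.\<close>

lemma oweno_error:
  assumes "r \<ge> 3" "\<delta> > 0" "Ck_on (2 * r - 1) f {z - \<delta><..<z + \<delta>}"
    "ideal_linear_weights kind r z \<alpha> c" "s2 > 0"
    and m: "1 \<le> m" "m \<le> 2 * r - 1" "\<And>n. 1 \<le> n \<Longrightarrow> n < m \<Longrightarrow> (deriv ^^ n) f z = 0"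
    and "2 * r - 1 \<le> m + k"
    and close: "\<forall>\<^sub>F h in at_right 0. \<forall>\<epsilon>>0. \<forall>i<r.
      \<bar>oweno_weight kind r z \<alpha> c s1 s2 \<epsilon> h (datum kind z \<alpha> h f) i - c i\<bar> \<le> H * h ^ k"
  shows "\<exists>K. \<forall>\<^sub>F h in at_right 0. \<forall>\<epsilon>>0. \<bar>f (node z \<alpha> h (1/2))
    - oweno_reconstruction kind r z \<alpha> c s1 s2 \<epsilon> h (datum kind z \<alpha> h f)\<bar> \<le> K * h ^ (2 * r - 1)"
proof -
  let ?p = "\<lambda>h i. poly (sub_poly kind r z \<alpha> h (datum kind z \<alpha> h f) i) (node z \<alpha> h (1/2))"
  have c: "\<And>i. i < r \<Longrightarrow> c i > 0" "(\<Sum>i<r. c i) = 1"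
    using assms(4) by (auto simp: ideal_linear_weights_def)
  have r1: "r \<ge> 1" using assms(1) by simp
  obtain K1 where K1: "\<forall>\<^sub>F h in at_right 0. \<bar>f (node z \<alpha> h (1/2))
    - poly (full_poly kind r z \<alpha> h (datum kind z \<alpha> h f)) (node z \<alpha> h (1/2))\<bar> \<le> K1 * h ^ (2 * r - 1)"
    using full_poly_error[OF assms(3,2) r1, where kind = kind and \<alpha> = \<alpha>] by blast
  have Cm: "Ck_on m f {z - \<delta><..<z + \<delta>}" by (rule Ck_on_mono[OF assms(3) m(2)]) simp
  obtain K2 where K2: "\<forall>\<^sub>F h in at_right 0. \<forall>i<r. h \<ge> 0 \<and> \<bar>?p h i - f z\<bar> \<le> K2 * h ^ m"
  \<comment> \<open>The conjunct \<open>h \<ge> 0\<close> makes the predicate monotone in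
    \<open>K\<close>.\<close>
  proof (rule eventually_uniform_const[where P = "\<lambda>i K h. h \<ge> 0 \<and> \<bar>?p h i - f z\<bar> \<le> K * h ^ m"])
    fix i assume "i < r"
    then obtain K where "\<forall>\<^sub>F h in at_right 0. \<bar>?p h i - f z\<bar> \<le> K * h ^ m"
      using sub_poly_near_const[OF Cm assms(2) m(1) _ m(3), of i r kind \<alpha>] by blast
    then show "\<exists>K. \<forall>\<^sub>F h in at_right 0. h \<ge> 0 \<and> \<bar>?p h i - f z\<bar> \<le> K * h ^ m"
      using eventually_at_right_less[of "0::real"]
      by (intro exI[of _ K], eventually_elim) auto
  next
    fix i K K' and h :: real assume "h \<ge> 0 \<and> \<bar>?p h i - f z\<bar> \<le> K * h ^ m" "K \<le> K'"
    then show "h \<ge> 0 \<and> \<bar>?p h i - f z\<bar> \<le> K' * h ^ m"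
      using mult_right_mono[of K K' "h ^ m"] by auto
  qed blast
  show ?thesis
  proof (rule exI[of _ "K1 + real r * (H * K2)"],
      use K1 K2 close eventually_at_right_0_small in eventually_elim, intro allI impI)
    case (elim h)
    fix \<epsilon> :: real assume \<epsilon>: "\<epsilon> > 0"
    let ?w = "oweno_weight kind r z \<alpha> c s1 s2 \<epsilon> h (datum kind z \<alpha> h f)"
    have w: "\<bar>?w i - c i\<bar> \<le> H * h ^ k" if "i < r" for i using elim(3) \<epsilon> that by blast
    have q: "oweno_reconstruction kind r z \<alpha> c s1 s2 \<epsilon> h (datum kind z \<alpha> h f) =
        poly (full_poly kind r z \<alpha> h (datum kind z \<alpha> h f)) (node z \<alpha> h (1/2)) +
        (\<Sum>i<r. (?w i - c i) * (?p h i - f z))"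
    proof -
      have "(\<Sum>i<r. c i * ?p h i) =
          poly (full_poly kind r z \<alpha> h (datum kind z \<alpha> h f)) (node z \<alpha> h (1/2))"
        using assms(4) elim(4) by (simp add: ideal_linear_weights_def)
      moreover have "(\<Sum>i<r. ?w i) = 1"
        using c \<epsilon> assms(1,5) by (intro oweno_weights) auto
      moreover have "(\<Sum>i<r. (?w i - c i) * (?p h i - f z)) =
          (\<Sum>i<r. ?w i * ?p h i) - (\<Sum>i<r. c i * ?p h i) - (\<Sum>i<r. ?w i) * f z + (\<Sum>i<r. c i) * f z"
        by (simp add: algebra_simps sum.distrib sum_subtractf sum_distrib_left sum_distrib_right)
      ultimately show ?thesis using c(2) by (simp add: oweno_reconstruction_def)
    qed
    have "\<bar>\<Sum>i<r. (?w i - c i) * (?p h i - f z)\<bar> \<le> (\<Sum>i<r. (H * h ^ k) * (K2 * h ^ m))"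
      using w elim(2)
      by (intro order.trans[OF sum_abs] sum_mono)
        (auto simp: abs_mult intro!: mult_mono intro: order.trans[OF abs_ge_zero])
    also have "\<dots> = real r * (H * K2) * h ^ (m + k)" by (simp add: power_add)
    also have "\<dots> \<le> real r * (H * K2) * h ^ (2 * r - 1)"
    \<comment> \<open>The signs of \<open>H\<close> and \<open>K2\<close> are read off at index 0,
      where their products with positive powers of \<open>h\<close> bound absolute values.\<close>
    proof (intro mult_left_mono power_decreasing mult_nonneg_nonneg)
      have "0 \<le> H * h ^ k" "0 \<le> K2 * h ^ m"
        using w[of 0] elim(2)[rule_format, of 0] assms(1) by (auto intro: order.trans[OF abs_ge_zero])
      moreover have "0 < h ^ k" "0 < h ^ m" using elim(4) by simp_all
      ultimately show "0 \<le> H" "0 \<le> K2" by (meson mult_neg_pos not_le)+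
    qed (use assms elim in auto)
    finally show "\<bar>f (node z \<alpha> h (1/2))
        - oweno_reconstruction kind r z \<alpha> c s1 s2 \<epsilon> h (datum kind z \<alpha> h f)\<bar>
      \<le> (K1 + real r * (H * K2)) * h ^ (2 * r - 1)"
      using elim(1) unfolding q distrib_right by linarith
  qed
qed

text \<open>The lower bound for \<open>I_i\<close> trades \<open>h^(2m)\<close> for a multiple of
  \<open>I_i\<close>, which brings \<open>D\<close> into the form \<open>B h^k I_i\<close> required
  for the factor bound.\<close>

lemma oweno_weights_close:
  assumes "r \<ge> 3" "\<delta> > 0" "Ck_on (2 * r - 1) f {z - \<delta><..<z + \<delta>}"
    "ideal_linear_weights kind r z \<alpha> c" "s1 \<ge> 1" "s2 > 0"
    and m: "1 \<le> m" "m \<le> 2 * r - 2" "\<And>n. 1 \<le> n \<Longrightarrow> n < m \<Longrightarrow> (deriv ^^ n) f z = 0"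
      "(deriv ^^ m) f z \<noteq> 0"
    and D: "\<forall>\<^sub>F h in at_right 0. d1 r (datum kind z \<alpha> h f) \<le> KD * h ^ (k + 2 * m) \<or>
      \<bar>d2 kind r z \<alpha> h (datum kind z \<alpha> h f)\<bar> \<le> KD * h ^ (k + 2 * m)"
  shows "\<exists>H. \<forall>\<^sub>F h in at_right 0. \<forall>\<epsilon>>0. \<forall>i<r.
      \<bar>oweno_weight kind r z \<alpha> c s1 s2 \<epsilon> h (datum kind z \<alpha> h f) i - c i\<bar> \<le> H * h ^ k"
proof -
  let ?I = "\<lambda>h i. smoothness_indicator kind r z \<alpha> h (datum kind z \<alpha> h f) i"
  have c: "\<And>i. i < r \<Longrightarrow> c i > 0" "(\<Sum>i<r. c i) = 1"
    using assms(4) by (auto simp: ideal_linear_weights_def)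
  have Cm: "Ck_on (Suc m) f {z - \<delta><..<z + \<delta>}"
    by (rule Ck_on_mono[OF assms(3)]) (use m(2) assms(1) in auto)
  obtain KI where KI: "KI \<ge> 0"
    "\<forall>\<^sub>F h in at_right 0. \<forall>i<r. 0 < ?I h i \<and> h ^ (2 * m) \<le> KI * ?I h i"
  proof (rule eventually_uniform_const[where P = "\<lambda>i K h. 0 < ?I h i \<and> h ^ (2 * m) \<le> K * ?I h i"])
    show "\<exists>K. \<forall>\<^sub>F h in at_right 0. 0 < ?I h i \<and> h ^ (2 * m) \<le> K * ?I h i" if "i < r" for i
      using smoothness_indicator_lower_bound[OF Cm assms(2) m(1) that assms(1) m(3,4)] .
    show "0 < ?I h i \<and> h ^ (2 * m) \<le> K' * ?I h i"
      if "0 < ?I h i \<and> h ^ (2 * m) \<le> K * ?I h i" "K \<le> K'" for i K K' h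
      using that(1) mult_right_mono[OF that(2) less_imp_le[OF conjunct1[OF that(1)]]] by linarith
  qed blast
  define B where "B = \<bar>KD\<bar> * KI"
  have "B \<ge> 0" using KI by (simp add: B_def)
  define H where "H = s2 * exp (s2 * B powr s1) * B powr s1"
  have "H \<ge> 0" using assms by (simp add: H_def)
  show ?thesis
  proof (rule exI[of _ H], use D KI(2) eventually_at_right_0_small in eventually_elim, intro allI impI)
    case (elim h)
    fix \<epsilon> :: real and i assume \<epsilon>: "\<epsilon> > 0" and i: "i < r"
    let ?u = "datum kind z \<alpha> h f"
    let ?\<gamma> = "\<lambda>i. (1 + oweno_d kind r z \<alpha> s1 \<epsilon> h ?u / (?I h i powr s1 + \<epsilon>)) powr s2"
    have up: "?\<gamma> j \<le> 1 + H * h ^ k" if j: "j < r" for j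
    proof -
      have "KD * h ^ (k + 2 * m) \<le> \<bar>KD\<bar> * h ^ k * h ^ (2 * m)"
        using elim by (simp add: power_add mult.assoc mult_right_mono)
      also have "\<dots> \<le> \<bar>KD\<bar> * h ^ k * (KI * ?I h j)"
        using elim j by (intro mult_left_mono) auto
      also have "\<dots> = B * h ^ k * ?I h j" by (simp add: B_def mult_ac)
      finally show ?thesis
        using elim j unfolding H_def
        by (intro oweno_factor_le) (use \<epsilon> assms \<open>B \<ge> 0\<close> in auto)
    qed
    have "\<bar>oweno_weight kind r z \<alpha> c s1 s2 \<epsilon> h ?u i - c i\<bar> \<le> c i * (H * h ^ k)"
      unfolding oweno_weight_eq
      by (rule normalized_weight_close) (use c up i oweno_factor_ge_1 \<epsilon> assms(6) in auto)
    also have "\<dots> \<le> 1 * (H * h ^ k)"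
    proof (rule mult_right_mono)
      show "c i \<le> 1" using member_le_sum[of i "{..<r}" c] i c by (auto simp: less_imp_le)
    qed (use \<open>H \<ge> 0\<close> elim in auto)
    finally show "\<bar>oweno_weight kind r z \<alpha> c s1 s2 \<epsilon> h ?u i - c i\<bar> \<le> H * h ^ k" by simp
  qed
qed

theorem theorem3p4:
  fixes kind :: data_kind and r :: nat and z \<alpha> \<delta> s1 s2 :: real
    and f :: "real \<Rightarrow> real" and c :: "nat \<Rightarrow> real"
  assumes "r \<ge> 3"
    and "\<delta> > 0" and "Ck_on (2 * r - 1) f {z - \<delta><..<z + \<delta>}"
    and "ideal_linear_weights kind r z \<alpha> c"
    and "s1 \<ge> 1" and "s2 > 0"
  shows "\<exists>K h0. h0 > 0 \<and> (\<forall>h \<epsilon>. 0 < h \<longrightarrow> h < h0 \<longrightarrow> 0 < \<epsilon> \<longrightarrow>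
      \<bar>f (node z \<alpha> h (1/2))
         - oweno_reconstruction kind r z \<alpha> c s1 s2 \<epsilon> h (datum kind z \<alpha> h f)\<bar>
      \<le> K * h ^ (2 * r - 1) + K * \<epsilon> powr s2)"
proof -
  let ?err = "\<lambda>h \<epsilon>. \<bar>f (node z \<alpha> h (1/2))
    - oweno_reconstruction kind r z \<alpha> c s1 s2 \<epsilon> h (datum kind z \<alpha> h f)\<bar>"
  let ?w = "\<lambda>\<epsilon> h. oweno_weight kind r z \<alpha> c s1 s2 \<epsilon> h (datum kind z \<alpha> h f)"
  \<comment> \<open>The range of \<open>h\<close> and the constant are fixed before
    \<open>\<epsilon>\<close>, and the bound has no \<open>\<epsilon>\<close> term.\<close>
  have "\<exists>K. \<forall>\<^sub>F h in at_right 0. \<forall>\<epsilon>>0. ?err h \<epsilon> \<le> K * h ^ (2 * r - 1)"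
  proof (cases "\<exists>n. 1 \<le> n \<and> n \<le> 2 * r - 2 \<and> (deriv ^^ n) f z \<noteq> 0")
    case True
    define m where "m = (LEAST n. 1 \<le> n \<and> (deriv ^^ n) f z \<noteq> 0)"
    have m: "1 \<le> m" "(deriv ^^ m) f z \<noteq> 0" "m \<le> 2 * r - 2"
      using True LeastI_ex[of "\<lambda>n. 1 \<le> n \<and> (deriv ^^ n) f z \<noteq> 0"]
        Least_le[of "\<lambda>n. 1 \<le> n \<and> (deriv ^^ n) f z \<noteq> 0"]
      unfolding m_def by (blast, blast, meson le_trans)
    have low: "(deriv ^^ n) f z = 0" if "1 \<le> n" "n < m" for n
      using not_less_Least[of n "\<lambda>n. 1 \<le> n \<and> (deriv ^^ n) f z \<noteq> 0"] that by (auto simp: m_def)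
    \<comment> \<open>Through \<open>d1\<close> one gets \<open>k = 4r - 4 - 2m\<close>, and
      \<open>m + k \<ge> 2r - 1\<close> holds for \<open>m \<le> 2r - 3\<close>. For
      \<open>m = 2r - 2\<close> this \<open>k\<close> would be 0, one short; \<open>d2\<close>
      yields \<open>k = 1\<close>.\<close>
    have "\<exists>k KD. 2 * r - 1 \<le> m + k \<and> (\<forall>\<^sub>F h in at_right 0.
      d1 r (datum kind z \<alpha> h f) \<le> KD * h ^ (k + 2 * m) \<or>
      \<bar>d2 kind r z \<alpha> h (datum kind z \<alpha> h f)\<bar> \<le> KD * h ^ (k + 2 * m))"
    proof (cases "m = 2 * r - 2")
      case True
      obtain K where "\<forall>\<^sub>F h in at_right 0. \<bar>d2 kind r z \<alpha> h (datum kind z \<alpha> h f)\<bar> \<le> K * h ^ (4 * r - 3)"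
        using d2_bound[OF assms(3,2,1)] low True by blast
      moreover have "4 * r - 3 = 1 + 2 * m" "2 * r - 1 \<le> m + 1" using True assms(1) by auto
      ultimately show ?thesis
        by (intro exI[of _ 1] exI[of _ K] conjI) (auto elim!: eventually_mono)
    next
      case False
      have r2: "r \<ge> 2" using assms(1) by simp
      have "Ck_on (2 * r - 2) f {z - \<delta><..<z + \<delta>}" by (rule Ck_on_mono[OF assms(3)]) auto
      then obtain K where "\<forall>\<^sub>F h in at_right 0. d1 r (datum kind z \<alpha> h f) \<le> K * h ^ (4 * r - 4)"
        using d1_bound[OF _ assms(2) r2, where kind = kind and \<alpha> = \<alpha>] by blast
      moreover have "4 * r - 4 = (4 * r - 4 - 2 * m) + 2 * m" "2 * r - 1 \<le> m + (4 * r - 4 - 2 * m)"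
        using False m(3) by auto
      ultimately show ?thesis
        by (intro exI[of _ "4 * r - 4 - 2 * m"] exI[of _ K] conjI) (auto elim!: eventually_mono)
    qed
    then obtain k KD where k: "2 * r - 1 \<le> m + k" and D: "\<forall>\<^sub>F h in at_right 0.
      d1 r (datum kind z \<alpha> h f) \<le> KD * h ^ (k + 2 * m) \<or>
      \<bar>d2 kind r z \<alpha> h (datum kind z \<alpha> h f)\<bar> \<le> KD * h ^ (k + 2 * m)"
      by blast
    obtain H where "\<forall>\<^sub>F h in at_right 0. \<forall>\<epsilon>>0. \<forall>i<r. \<bar>?w \<epsilon> h i - c i\<bar> \<le> H * h ^ k"
      using oweno_weights_close[OF assms m(1,3) low m(2) D] by blast
    moreover have "m \<le> 2 * r - 1" using m(3) by simp
    ultimately show ?thesis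
      using oweno_error[OF assms(1-4,6) m(1) _ low k] by blast
  next
    case False
    \<comment> \<open>Here \<open>m = 2 * r - 1\<close> and \<open>k = 0\<close>: the substencil
      values are so close to \<open>f z\<close> that bounded weights suffice.\<close>
    then have "\<And>n. 1 \<le> n \<Longrightarrow> n < 2 * r - 1 \<Longrightarrow> (deriv ^^ n) f z = 0" by force
    moreover have "\<forall>\<epsilon>>0. \<forall>i<r. \<bar>?w \<epsilon> h i - c i\<bar> \<le> 1 * h ^ 0" for h
      using assms by (auto intro!: oweno_weights simp: ideal_linear_weights_def)
    ultimately show ?thesis
      using oweno_error[OF assms(1-4,6), of "2 * r - 1" 0 s1 1] assms(1) by auto
  qed
  then obtain K h0 where K: "h0 > 0"
    "\<And>h \<epsilon>. 0 < h \<Longrightarrow> h < h0 \<Longrightarrow> 0 < \<epsilon> \<Longrightarrow> ?err h \<epsilon> \<le> K * h ^ (2 * r - 1)"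
    unfolding eventually_at_right_field by blast
  \<comment> \<open>Taking \<open>\<bar>K\<bar>\<close> makes the added \<open>\<epsilon>\<close>
    term nonnegative, so the claimed bound follows from the stronger one.\<close>
  have "?err h \<epsilon> \<le> \<bar>K\<bar> * h ^ (2 * r - 1) + \<bar>K\<bar> * \<epsilon> powr s2"
    if "0 < h" "h < h0" "0 < \<epsilon>" for h \<epsilon>
  proof -
    have "K * h ^ (2 * r - 1) \<le> \<bar>K\<bar> * h ^ (2 * r - 1)" using that by (intro mult_right_mono) auto
    moreover have "0 \<le> \<bar>K\<bar> * \<epsilon> powr s2" by simp
    ultimately show ?thesis using K(2)[OF that] by linarith
  qed
  then show ?thesis using K(1) by blast
qed

end
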